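(* Let $\alpha\in H^1(T^3;\mathbb{R})\cong\mathbb{R}^3$ and let $\mathcal{D}_\alpha$ be the $\mathrm{Spin}^{\mathbb{C}}$ Dirac operator on sections of $\underline{\mathbb{H}}=\underline{\mathbb{C}}^2$ over $T^3=\mathbb{R}^3/\mathbb{Z}^3$ for the trivial $\mathrm{Spin}^{\mathbb{C}}$ structure and the connection $d+\mathtt{i}\alpha$. For $b\in\mathbb{Z}^3$ let $\sigma_b(x)=\exp(2\pi\mathtt{i}(b_1x_1+b_2x_2+b_3x_3))$, $\sigma_b^+=(\sigma_b,0)$, $\sigma_b^-=(0,\sigma_b)$ and $\beta=\beta(b,\alpha)=\alpha+2\pi b\in\mathbb{R}^3$. Then $$\big\{\|\beta\|\sigma_b^+-\mathcal{D}_\alpha\sigma_b^+\mid b\in\mathbb{Z}^3,\ \beta_2\ne0\text{ or }\beta_3\ne0\big\}\cup\big\{\|\beta\|\sigma_b^++\mathcal{D}_\alpha\sigma_b^+\mid b\in\mathbb{Z}^3,\ \beta_2\neq0\text{ or }\beta_3\ne0\big\}\cup\big\{\sigma_b^+,\sigma_b^-\mid b\in\mathbb{Z}^3,\ \beta_2=\beta_3=0\big\}$$ is an orthogonal eigenbasis for $\mathcal{D}_\alpha$ (orthogonal family of nonzero eigensections with dense span in $L^2$). Furthermore, whenever $\beta_2\ne0$ or $\beta_3\neq0$, $$\mathrm{span}\{\sigma_b^+,\sigma_b^-\}=\mathrm{span}\big\{\|\beta\|\sigma_b^+-\mathcal{D}_\alpha\sigma_b^+,\ \|\beta\|\sigma_b^++\mathcal{D}_\alpha\sigma_b^+\big\}.$$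 The spectrum of $\mathcal{D}_\alpha$ consists of all numbers $\pm\|\beta(b,\alpha)\|$ for $b\in\mathbb{Z}^3$.
   Context: $H^1(T^3;\mathbb{R})$ is identified with $\mathbb{R}^3$ via the harmonic forms $dx_1,dx_2,dx_3$. $\mathbb{H}=\mathrm{span}_{\mathbb{R}}\{e_0,e_1,e_2,e_3\}$ is the space of quaternions, a complex vector space by left multiplication with $\mathtt{i}=e_1$, identified with $\mathbb{C}^2$ through the complex basis $e_0,e_2$; Clifford multiplication is $c(dx_j)v=ve_j^{-1}=-ve_j$. The Dirac operator is $\mathcal{D}_\alpha=\sum_{j}c(dx_j)(\partial_j+\mathtt{i}\alpha_j)$. *)

theory Defs
  imports "HOL-Analysis.Analysis" "HOL-Library.Function_Algebras"
begin

text \<open>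
  The pair (z, w) stands for the quaternion z e0 + w e2, with complex numbers embedded by
  a + b i = a e0 + b e1.  Since e2 z = cnj z e2, the Hamilton product takes the form below.
  The lemmas after the definitions show that this is the usual quaternion algebra and that
  left multiplication by complex numbers is \<open>*s\<close>.
\<close>

definition qmult :: "complex^2 \<Rightarrow> complex^2 \<Rightarrow> complex^2"  (infixl "\<otimes>\<^sub>q" 70) where
  "p \<otimes>\<^sub>q q = vector [p $ 1 * q $ 1 - p $ 2 * cnj (q $ 2), p $ 1 * q $ 2 + p $ 2 * cnj (q $ 1)]"

definition e0 :: "complex^2" where
  "e0 = vector [1, 0]"

definition qe :: "3 \<Rightarrow> complex^2" where
  "qe j = (if j = 1 then vector [\<i>, 0] else if j = 2 then vector [0, 1] else vector [0, \<i>])"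

lemmas quaternion_simps = qmult_def e0_def qe_def vec_eq_iff forall_2 vector_2 complex_eq_iff

lemma bilinear_qmult: "bilinear (\<otimes>\<^sub>q)"
  by (auto simp: bilinear_def intro!: linearI)
     (auto simp: quaternion_simps algebra_simps)

lemma Hamilton_relations:
  "e0 \<otimes>\<^sub>q v = v" "v \<otimes>\<^sub>q e0 = v"
  "qe j \<otimes>\<^sub>q qe j = - e0"
  "qe 1 \<otimes>\<^sub>q qe 2 = qe 3" "qe 2 \<otimes>\<^sub>q qe 3 = qe 1" "qe 3 \<otimes>\<^sub>q qe 1 = qe 2"
  "qe 2 \<otimes>\<^sub>q qe 1 = - qe 3" "qe 3 \<otimes>\<^sub>q qe 2 = - qe 1" "qe 1 \<otimes>\<^sub>q qe 3 = - qe 2"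
  by (auto simp: quaternion_simps)

lemma quaternion_real_coordinates:
  "v = Re (v $ 1) *\<^sub>R e0 + Im (v $ 1) *\<^sub>R qe 1 + Re (v $ 2) *\<^sub>R qe 2 + Im (v $ 2) *\<^sub>R qe 3"
  by (auto simp: quaternion_simps)

lemma complex_structure:
  "(Re c *\<^sub>R e0 + Im c *\<^sub>R qe 1) \<otimes>\<^sub>q v = c *s v"
  by (auto simp: quaternion_simps)

text \<open>Clifford multiplication by \<open>dx_j\<close> is right multiplication by the inverse of \<open>e_j\<close>.\<close>

definition clifford :: "3 \<Rightarrow> complex^2 \<Rightarrow> complex^2" where
  "clifford j v = v \<otimes>\<^sub>q (- qe j)"

lemma qe_inverse: "qe j \<otimes>\<^sub>q (- qe j) = e0" "(- qe j) \<otimes>\<^sub>q qe j = e0"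
  by (auto simp: quaternion_simps)

text \<open>Sections of the trivial bundle over the torus are the functions on the universal cover
  that are invariant under integer translations.\<close>

type_synonym sect = "real^3 \<Rightarrow> complex^2"

definition section_scale :: "complex \<Rightarrow> sect \<Rightarrow> sect" where
  "section_scale c f = (\<lambda>x. c *s f x)"

interpretation sections: vector_space section_scale
  by unfold_locales
     (auto simp: section_scale_def fun_eq_iff vec_eq_iff algebra_simps)

definition partial :: "3 \<Rightarrow> sect \<Rightarrow> sect" where
  "partial j f = (\<lambda>x. frechet_derivative f (at x) (axis j 1))"

primrec C_k :: "nat \<Rightarrow> sect \<Rightarrow> bool" where
  "C_k 0 f = continuous_on UNIV f"
| "C_k (Suc k) f = ((\<forall>x. f differentiable (at x)) \<and> (\<forall>j. C_k k (partial j f)))"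

definition lattice_vec :: "int^3 \<Rightarrow> real^3" where
  "lattice_vec b = (\<chi> j. of_int (b $ j))"

definition smooth_sections :: "sect set" where
  "smooth_sections = {f. (\<forall>k. C_k k f) \<and> (\<forall>x b. f (x + lattice_vec b) = f x)}"

definition Dirac :: "real^3 \<Rightarrow> sect \<Rightarrow> sect" where
  "Dirac \<alpha> f = (\<lambda>x. \<Sum>j\<in>UNIV. clifford j (partial j f x + (\<i> * complex_of_real (\<alpha> $ j)) *s f x))"

text \<open>The unit cube is a fundamental domain, so a class in \<open>L\<^sup>2\<close> of the torus is determined by its
  restriction to the cube; values elsewhere are irrelevant.\<close>

abbreviation torus :: "(real^3) measure" where
  "torus \<equiv> lebesgue_on (cbox 0 1)"

definition L2 :: "sect set" where
  "L2 = {f. f \<in> borel_measurable torus \<and> integrable torus (\<lambda>x. (norm (f x))\<^sup>2)}"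

definition L2_inner :: "sect \<Rightarrow> sect \<Rightarrow> complex" where
  "L2_inner f g = integral\<^sup>L torus (\<lambda>x. \<Sum>k\<in>UNIV. f x $ k * cnj (g x $ k))"

definition L2_norm :: "sect \<Rightarrow> real" where
  "L2_norm f = sqrt (integral\<^sup>L torus (\<lambda>x. (norm (f x))\<^sup>2))"

definition orthogonal_eigenbasis :: "(sect \<Rightarrow> sect) \<Rightarrow> sect set \<Rightarrow> bool" where
  "orthogonal_eigenbasis T E \<longleftrightarrow>
     (\<forall>f\<in>E. f \<in> smooth_sections \<and> f \<noteq> 0 \<and> (\<exists>\<mu>. T f = section_scale \<mu> f)) \<and>
     pairwise (\<lambda>f g. L2_inner f g = 0) E \<and>
     (\<forall>h\<in>L2. \<forall>\<epsilon>>0. \<exists>g\<in>sections.span E. L2_norm (h - g) < \<epsilon>)"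

text \<open>The graph of the closure in \<open>L\<^sup>2\<close> of the operator \<open>T\<close> with domain the smooth sections.\<close>

definition closure_graph :: "(sect \<Rightarrow> sect) \<Rightarrow> (sect \<times> sect) set" where
  "closure_graph T = {(f, g). f \<in> L2 \<and> g \<in> L2 \<and>
     (\<exists>u. (\<forall>n. u n \<in> smooth_sections) \<and>
       (\<lambda>n. L2_norm (u n - f)) \<longlonglongrightarrow> 0 \<and> (\<lambda>n. L2_norm (T (u n) - g)) \<longlonglongrightarrow> 0)}"

text \<open>\<open>\<mu>\<close> is in the resolvent set if the closure minus \<open>\<mu>\<close> is a bijection from its domain
  onto \<open>L\<^sup>2\<close> with bounded inverse.  The estimate is the bound on the inverse and contains
  injectivity.\<close>

definition resolvent_set :: "(sect \<Rightarrow> sect) \<Rightarrow> complex set" where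
  "resolvent_set T = {\<mu>.
     (\<exists>C. \<forall>(f, g)\<in>closure_graph T. L2_norm f \<le> C * L2_norm (g - section_scale \<mu> f)) \<and>
     (\<forall>h\<in>L2. \<exists>(f, g)\<in>closure_graph T. AE x in torus. (g - section_scale \<mu> f) x = h x)}"

definition spectrum :: "(sect \<Rightarrow> sect) \<Rightarrow> complex set" where
  "spectrum T = - resolvent_set T"

definition \<sigma> :: "int^3 \<Rightarrow> real^3 \<Rightarrow> complex" where
  "\<sigma> b x = exp (2 * complex_of_real pi * \<i> *
     (of_int (b $ 1) * complex_of_real (x $ 1) + of_int (b $ 2) * complex_of_real (x $ 2)
       + of_int (b $ 3) * complex_of_real (x $ 3)))"

definition \<sigma>_plus :: "int^3 \<Rightarrow> sect" where
  "\<sigma>_plus b = (\<lambda>x. vector [\<sigma> b x, 0])"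

definition \<sigma>_minus :: "int^3 \<Rightarrow> sect" where
  "\<sigma>_minus b = (\<lambda>x. vector [0, \<sigma> b x])"

definition \<beta> :: "int^3 \<Rightarrow> real^3 \<Rightarrow> real^3" where
  "\<beta> b \<alpha> = \<alpha> + (2 * pi) *\<^sub>R lattice_vec b"

end

theory Submission
  imports Defs
begin

text \<open>
  On the span of \<open>\<sigma>_plus b\<close> and \<open>\<sigma>_minus b\<close> the Dirac operator is the Hermitian matrix \<open>symbol (\<beta> b \<alpha>)\<close>,
  whose square is \<open>(norm (\<beta> b \<alpha>))\<^sup>2\<close>; this gives the eigenvectors and, by \<open>(S - \<mu>) (S + \<mu>) = S\<^sup>2 - \<mu>\<^sup>2\<close>,
  the resolvent of each block.  The resolvents of the blocks are uniformly bounded because the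
  frequencies \<open>\<beta> b \<alpha>\<close> are discrete.

  Let \<open>\<mu>\<close> be none of the numbers \<open>\<plusminus>norm (\<beta> b \<alpha>)\<close>.  A smooth section \<open>u\<close> is bounded by \<open>(D - \<mu>) u\<close> by duality:
  the inner product of \<open>u\<close> with a trigonometric polynomial \<open>p\<close> is that of \<open>(D - \<mu>) u\<close> with the solution
  \<open>q\<close> of \<open>(D - cnj \<mu>) q = p\<close>, and trigonometric polynomials are dense in \<open>L\<^sup>2\<close>.  Hence a sequence of
  trigonometric polynomials converging to \<open>h\<close> is the image of a Cauchy sequence, whose limit solves
  \<open>(D - \<mu>) f = h\<close> for the closure.
\<close>

section \<open>Integrals of periodic derivatives\<close>

text \<open>The closure in the definition of the spectrum is generated by all smooth sections, and
  density in L2 of the trigonometric polynomials does not by itself carry a bound from them to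
  smooth sections, since it gives no control of the derivatives. Two facts about a smooth section
  replace the convergence of its Fourier series: integration by parts, by which the operator acts on
  each Fourier coefficient through \<open>symbol\<close>, and the pairing with finite sums of waves,
  which sees only finitely many coefficients at a time. Since \<open>\<mu>\<close> is an arbitrary
  complex number, the dual problem has the parameter \<open>cnj \<mu>\<close>, but its denominators
  \<open>(norm \<xi>)\<^sup>2 - (cnj \<mu>)\<^sup>2\<close> have the same modulus, so one constant
  serves both. The single condition \<open>(norm \<xi>)\<^sup>2 \<noteq> \<mu>\<^sup>2\<close>
  excludes both signs of the eigenvalue. Density is proved for functions that vanish on the boundary
  of the cube. This loses nothing in L2, because the boundary is negligible, and it removes the
  question of matching values on opposite faces.\<close>

lemma integral_cube_shift:
  fixes f :: "real^'n \<Rightarrow> 'b::euclidean_space"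
  assumes f: "continuous_on UNIV f" and per: "\<And>x. f (x + axis j 1) = f x" and t: "0 \<le> t" "t \<le> 1"
  shows "integral (cbox 0 1) (\<lambda>x. f (x + t *\<^sub>R axis j 1)) = integral (cbox 0 1) f"
proof -
  let ?e = "axis j 1 :: real^'n"
  have int: "f integrable_on cbox a b" for a b
    by (rule integrable_continuous) (rule continuous_on_subset[OF f], simp)
  have basis: "?e \<in> Basis"
    by (simp add: axis_in_Basis_iff)
  have split: "integral (cbox a b) f
      = integral (cbox a (b + (c - b $ j) *\<^sub>R ?e)) f + integral (cbox (a + (c - a $ j) *\<^sub>R ?e) b) f"
    if "a $ j \<le> c" "c \<le> b $ j" for a b c
  proof -
    have nth: "(y + (c - y $ j) *\<^sub>R ?e) $ i = (if i = j then c else y $ i)" for y i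
      by (simp add: axis_def)
    have "cbox a b \<inter> {x. x \<bullet> ?e \<le> c} = cbox a (b + (c - b $ j) *\<^sub>R ?e)"
      "cbox a b \<inter> {x. x \<bullet> ?e \<ge> c} = cbox (a + (c - a $ j) *\<^sub>R ?e) b"
      unfolding set_eq_iff Int_iff mem_Collect_eq mem_box_cart inner_axis nth
      using that by (auto split: if_splits intro: order_trans)
    then show ?thesis
      using integral_split[OF int basis, of a b c] by simp
  qed
  have "integral (cbox 0 1) (\<lambda>x. f (x + t *\<^sub>R ?e)) = integral (cbox (t *\<^sub>R ?e) (1 + t *\<^sub>R ?e)) f"
    using integral_shift_cbox[of "t *\<^sub>R ?e" "t *\<^sub>R ?e" "1 + t *\<^sub>R ?e" f] by simp
  \<comment> \<open>The translated cube is cut at the face \<open>x $ j = 1\<close>; the part beyond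
    it is moved back by one period and becomes the slab with \<open>x $ j \<le> t\<close> that was
    missing.\<close>
  also have "\<dots> = integral (cbox (t *\<^sub>R ?e) 1) f + integral (cbox ?e (1 + t *\<^sub>R ?e)) f"
    using split[of "t *\<^sub>R ?e" 1 "1 + t *\<^sub>R ?e"] t
    by (simp add: axis_def flip: scaleR_left.add)
  also have "integral (cbox ?e (1 + t *\<^sub>R ?e)) f = integral (cbox 0 (1 + t *\<^sub>R ?e - ?e)) f"
    using integral_shift_cbox[of ?e ?e "1 + t *\<^sub>R ?e" f] per by simp
  also have "integral (cbox (t *\<^sub>R ?e) 1) f + integral (cbox 0 (1 + t *\<^sub>R ?e - ?e)) f = integral (cbox 0 1) f"
    using split[of 0 t 1] t by (simp add: algebra_simps)
  finally show ?thesis .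
qed

text \<open>By periodicity, the integral of \<open>g\<close> may be averaged over the translates along the axis \<open>j\<close>;
  exchanging the integrals leaves \<open>f (x + axis j 1) - f x = 0\<close>.\<close>

lemma integral_cube_derivative_eq_0:
  fixes f g :: "real^'n \<Rightarrow> 'b::euclidean_space"
  assumes deriv: "\<And>x t. ((\<lambda>t. f (x + t *\<^sub>R axis j 1)) has_vector_derivative g (x + t *\<^sub>R axis j 1)) (at t)"
    and g: "continuous_on UNIV g"
    and per: "\<And>x. f (x + axis j 1) = f x" "\<And>x. g (x + axis j 1) = g x"
  shows "integral (cbox 0 1) g = 0"
proof -
  let ?e = "axis j 1 :: real^'n"
  have cont: "continuous_on A (\<lambda>(x, t). g (x + t *\<^sub>R ?e))" for A
    by (auto simp: case_prod_beta intro!: continuous_intros continuous_on_compose2[OF g])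
  have inner: "integral (cbox 0 1) (\<lambda>t. g (x + t *\<^sub>R ?e)) = 0" for x
  proof -
    have "((\<lambda>t. g (x + t *\<^sub>R ?e)) has_integral f (x + 1 *\<^sub>R ?e) - f (x + 0 *\<^sub>R ?e)) {0..1}"
      by (intro fundamental_theorem_of_calculus) (auto intro: has_vector_derivative_at_within deriv)
    then show ?thesis
      by (simp add: per cbox_interval integral_unique)
  qed
  have "integral (cbox 0 1) g = integral (cbox 0 (1::real)) (\<lambda>t. integral (cbox 0 1) (\<lambda>x. g (x + t *\<^sub>R ?e)))"
  proof -
    have "integral (cbox 0 (1::real)) (\<lambda>t. integral (cbox 0 1) (\<lambda>x. g (x + t *\<^sub>R ?e)))
        = integral (cbox 0 (1::real)) (\<lambda>t. integral (cbox 0 1) g)"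
      by (intro integral_cong integral_cube_shift g per) auto
    then show ?thesis by simp
  qed
  also have "\<dots> = integral (cbox 0 1) (\<lambda>x. integral (cbox 0 1) (\<lambda>t. g (x + t *\<^sub>R ?e)))"
    by (rule integral_swap_continuous[symmetric]) (rule cont)
  also have "\<dots> = 0"
    by (simp add: inner del: box_real)
  finally show ?thesis .
qed

section \<open>The inner product on square integrable sections\<close>

lemma Cauchy_Schwarz_integral:
  fixes f g :: "'a \<Rightarrow> real"
  assumes [measurable]: "f \<in> borel_measurable M" "g \<in> borel_measurable M"
    and f: "integrable M (\<lambda>x. (f x)\<^sup>2)" and g: "integrable M (\<lambda>x. (g x)\<^sup>2)"
  shows "integrable M (\<lambda>x. f x * g x)"
    and "integral\<^sup>L M (\<lambda>x. \<bar>f x * g x\<bar>)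
      \<le> sqrt (integral\<^sup>L M (\<lambda>x. (f x)\<^sup>2)) * sqrt (integral\<^sup>L M (\<lambda>x. (g x)\<^sup>2))"
proof -
  show int: "integrable M (\<lambda>x. f x * g x)"
  proof (rule Bochner_Integration.integrable_bound)
    show "integrable M (\<lambda>x. (f x)\<^sup>2 + (g x)\<^sup>2)"
      using f g by simp
    have "\<bar>f x * g x\<bar> \<le> (f x)\<^sup>2 + (g x)\<^sup>2" for x
    proof -
      have "2 * (\<bar>f x\<bar> * \<bar>g x\<bar>) \<le> (f x)\<^sup>2 + (g x)\<^sup>2"
        using sum_squares_bound[of "\<bar>f x\<bar>" "\<bar>g x\<bar>"] by simp
      moreover have "0 \<le> \<bar>f x\<bar> * \<bar>g x\<bar>" by simp
      ultimately show ?thesis by (simp only: abs_mult)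
    qed
    then show "AE x in M. norm (f x * g x) \<le> norm ((f x)\<^sup>2 + (g x)\<^sup>2)"
      by simp
  qed simp
  \<comment> \<open>The inequality is taken from \<open>nn_integral\<close> in squared form;
    integrability of the three functions turns every term into a real integral.\<close>
  have "ennreal ((integral\<^sup>L M (\<lambda>x. \<bar>f x * g x\<bar>))\<^sup>2) = (\<integral>\<^sup>+x. ennreal \<bar>f x\<bar> * ennreal \<bar>g x\<bar> \<partial>M)\<^sup>2"
    using int nn_integral_eq_integral[of M "\<lambda>x. \<bar>f x * g x\<bar>"] integrable_abs[OF int]
    by (simp add: ennreal_power abs_mult flip: ennreal_mult)
  also have "\<dots> \<le> (\<integral>\<^sup>+x. (ennreal \<bar>f x\<bar>)\<^sup>2 \<partial>M) * (\<integral>\<^sup>+x. (ennreal \<bar>g x\<bar>)\<^sup>2 \<partial>M)"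
    by (rule Cauchy_Schwarz_nn_integral) auto
  also have "\<dots> = ennreal (integral\<^sup>L M (\<lambda>x. (f x)\<^sup>2) * integral\<^sup>L M (\<lambda>x. (g x)\<^sup>2))"
    using f g by (simp add: nn_integral_eq_integral ennreal_power ennreal_mult)
  finally have "(integral\<^sup>L M (\<lambda>x. \<bar>f x * g x\<bar>))\<^sup>2
      \<le> integral\<^sup>L M (\<lambda>x. (f x)\<^sup>2) * integral\<^sup>L M (\<lambda>x. (g x)\<^sup>2)"
    by simp
  then show "integral\<^sup>L M (\<lambda>x. \<bar>f x * g x\<bar>)
      \<le> sqrt (integral\<^sup>L M (\<lambda>x. (f x)\<^sup>2)) * sqrt (integral\<^sup>L M (\<lambda>x. (g x)\<^sup>2))"
    by (simp add: real_le_rsqrt flip: real_sqrt_mult)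
qed

lemma finite_measure_torus: "finite_measure torus"
  by (rule finite_measure_lebesgue_on) simp

lemma measure_torus: "measure torus (space torus) = 1"
proof -
  have "cbox 0 (1::real^3) \<noteq> {}"
    by (simp add: interval_ne_empty_cart)
  then show ?thesis
    by (simp add: measure_restrict_space space_restrict_space content_cbox_cart)
qed

lemma L2_measurable [measurable_dest]: "f \<in> L2 \<Longrightarrow> f \<in> borel_measurable torus"
  and L2_integrable: "f \<in> L2 \<Longrightarrow> integrable torus (\<lambda>x. (norm (f x))\<^sup>2)"
  by (auto simp: L2_def)

lemma L2_bounded:
  assumes [measurable]: "f \<in> borel_measurable torus" and b: "\<And>x. x \<in> cbox 0 1 \<Longrightarrow> norm (f x) \<le> B"
  shows "f \<in> L2"
proof -
  interpret finite_measure torus by (rule finite_measure_torus)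
  have "integrable torus (\<lambda>x. (norm (f x))\<^sup>2)"
    by (rule integrable_const_bound[of _ "B\<^sup>2"]) (auto intro!: AE_I2 power_mono b)
  then show ?thesis by (simp add: L2_def)
qed

lemma L2_continuous:
  assumes "continuous_on (cbox 0 1) f"
  shows "f \<in> L2"
proof -
  have "compact (f ` cbox 0 1)"
    by (rule compact_continuous_image[OF assms]) simp
  then obtain B where "\<forall>y\<in>f ` cbox 0 1. norm y \<le> B"
    by (meson bounded_iff compact_imp_bounded)
  then show ?thesis
    by (intro L2_bounded[of _ B]) (auto intro: continuous_imp_measurable_on_sets_lebesgue assms)
qed

lemma L2_add: assumes f: "f \<in> L2" and g: "g \<in> L2" shows "f + g \<in> L2"
proof -
  note [measurable] = L2_measurable[OF f] L2_measurable[OF g]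
  have "integrable torus (\<lambda>x. (norm (f x + g x))\<^sup>2)"
  proof (rule Bochner_Integration.integrable_bound)
    show "integrable torus (\<lambda>x. 2 * (norm (f x))\<^sup>2 + 2 * (norm (g x))\<^sup>2)"
      using L2_integrable[OF f] L2_integrable[OF g] by simp
    have "(norm (f x + g x))\<^sup>2 \<le> 2 * (norm (f x))\<^sup>2 + 2 * (norm (g x))\<^sup>2" for x
    proof -
      have "(norm (f x + g x))\<^sup>2 \<le> (norm (f x) + norm (g x))\<^sup>2"
        by (intro power_mono norm_triangle_ineq) simp
      also have "\<dots> \<le> 2 * (norm (f x))\<^sup>2 + 2 * (norm (g x))\<^sup>2"
        using sum_squares_bound[of "norm (f x)" "norm (g x)"] by (simp add: power2_sum)
      finally show ?thesis .
    qed
    then show "AE x in torus. norm ((norm (f x + g x))\<^sup>2) \<le> norm (2 * (norm (f x))\<^sup>2 + 2 * (norm (g x))\<^sup>2)"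
      by simp
  qed simp
  then show ?thesis
    by (simp add: L2_def plus_fun_def)
qed

lemma norm_vector_scalar_mult: "norm (c *s v) = norm c * norm (v :: complex^'n)"
  by (simp add: norm_vec_def L2_set_def norm_mult power_mult_distrib real_sqrt_mult
      flip: sum_distrib_left)

lemma vector_scalar_mult_eq: "c *s v = (\<chi> i. c * v $ i)"
  by (simp add: vec_eq_iff)

lemma continuous_on_vector_scalar_mult [continuous_intros]:
  fixes f :: "'a::topological_space \<Rightarrow> complex" and g :: "'a \<Rightarrow> complex^'n"
  assumes "continuous_on A f" "continuous_on A g"
  shows "continuous_on A (\<lambda>x. f x *s g x)"
  unfolding vector_scalar_mult_eq by (intro continuous_intros assms)

lemma L2_scale: assumes f: "f \<in> L2" shows "section_scale c f \<in> L2"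
proof -
  note [measurable] = L2_measurable[OF f]
  have [measurable]: "(\<lambda>v. c *s v :: complex^2) \<in> borel_measurable borel"
    by (intro borel_measurable_continuous_onI continuous_intros)
  show ?thesis
    using L2_integrable[OF f]
    by (simp add: L2_def section_scale_def norm_vector_scalar_mult power_mult_distrib)
qed

lemma L2_diff: assumes f: "f \<in> L2" and g: "g \<in> L2" shows "f - g \<in> L2"
proof -
  have "f - g = f + section_scale (-1) g"
    by (auto simp: section_scale_def fun_eq_iff vec_eq_iff)
  then show ?thesis
    using L2_add[OF f L2_scale[OF g]] by metis
qed

lemma L2_norm_nonneg [simp]: "0 \<le> L2_norm f"
  by (simp add: L2_norm_def)

lemma L2_norm_power2: "(L2_norm f)\<^sup>2 = integral\<^sup>L torus (\<lambda>x. (norm (f x))\<^sup>2)"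
  by (simp add: L2_norm_def)

lemma L2_norm_scale [simp]: "L2_norm (section_scale c f) = norm c * L2_norm f"
  by (simp add: L2_norm_def section_scale_def norm_vector_scalar_mult power_mult_distrib real_sqrt_mult)

lemma L2_norm_minus_commute: "L2_norm (f - g) = L2_norm (g - f)"
  by (simp add: L2_norm_def norm_minus_commute)

lemma norm_sum_mult_cnj_le:
  fixes v w :: "complex^'n"
  shows "norm (\<Sum>k\<in>UNIV. v $ k * cnj (w $ k)) \<le> norm v * norm w"
proof -
  have "norm (\<Sum>k\<in>UNIV. v $ k * cnj (w $ k)) \<le> (\<Sum>k\<in>UNIV. \<bar>norm (v $ k)\<bar> * \<bar>norm (w $ k)\<bar>)"
    by (rule order_trans[OF norm_sum]) (simp add: norm_mult)
  also have "\<dots> \<le> norm v * norm w"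
    unfolding norm_vec_def by (rule L2_set_mult_ineq)
  finally show ?thesis .
qed

text \<open>Cauchy-Schwarz in \<open>complex^2\<close> at each point reduces everything to the
  scalar functions \<open>norm (f x)\<close> and \<open>norm (g x)\<close>. The bound on the
  integral of their product is kept as a separate fact for the triangle inequality.\<close>

lemma L2_inner_bound:
  assumes f: "f \<in> L2" and g: "g \<in> L2"
  shows L2_inner_integrable: "integrable torus (\<lambda>x. \<Sum>k\<in>UNIV. f x $ k * cnj (g x $ k))"
    and Cauchy_Schwarz_L2: "norm (L2_inner f g) \<le> L2_norm f * L2_norm g"
    and L2_norm_product: "integral\<^sup>L torus (\<lambda>x. norm (f x) * norm (g x)) \<le> L2_norm f * L2_norm g"
proof -
  note [measurable] = L2_measurable[OF f] L2_measurable[OF g]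
  have [measurable]: "(\<lambda>v :: complex^2. v $ k) \<in> borel_measurable borel" for k
    by (intro borel_measurable_continuous_onI continuous_intros)
  have [measurable]: "cnj \<in> borel_measurable borel"
    by (intro borel_measurable_continuous_onI continuous_intros)
  note CS = Cauchy_Schwarz_integral[of "\<lambda>x. norm (f x)" torus "\<lambda>x. norm (g x)",
      OF _ _ L2_integrable[OF f] L2_integrable[OF g]]
  show int: "integrable torus (\<lambda>x. \<Sum>k\<in>UNIV. f x $ k * cnj (g x $ k))"
    by (rule Bochner_Integration.integrable_bound[OF CS(1)])
      (auto intro!: AE_I2 norm_sum_mult_cnj_le)
  show prod: "integral\<^sup>L torus (\<lambda>x. norm (f x) * norm (g x)) \<le> L2_norm f * L2_norm g"
    using CS(2) by (simp add: L2_norm_def)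
  have "norm (L2_inner f g) \<le> integral\<^sup>L torus (\<lambda>x. norm (f x) * norm (g x))"
    unfolding L2_inner_def
    by (rule Bochner_Integration.integral_norm_bound_integral[OF int CS(1)]) (auto intro: norm_sum_mult_cnj_le)
  with prod show "norm (L2_inner f g) \<le> L2_norm f * L2_norm g" by simp
qed

lemma L2_norm_triangle:
  assumes f: "f \<in> L2" and g: "g \<in> L2"
  shows "L2_norm (f + g) \<le> L2_norm f + L2_norm g"
proof (rule power2_le_imp_le)
  note [measurable] = L2_measurable[OF f] L2_measurable[OF g]
  note int = L2_integrable[OF f] L2_integrable[OF g]
    Cauchy_Schwarz_integral(1)[of "\<lambda>x. norm (f x)" torus "\<lambda>x. norm (g x)", OF _ _ L2_integrable[OF f] L2_integrable[OF g]]
  have "(L2_norm (f + g))\<^sup>2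
      \<le> integral\<^sup>L torus (\<lambda>x. (norm (f x))\<^sup>2 + (norm (g x))\<^sup>2 + 2 * (norm (f x) * norm (g x)))"
    unfolding L2_norm_power2
  proof (rule integral_mono)
    show "integrable torus (\<lambda>x. (norm ((f + g) x))\<^sup>2)"
      using L2_add[OF f g] by (rule L2_integrable)
    show "integrable torus (\<lambda>x. (norm (f x))\<^sup>2 + (norm (g x))\<^sup>2 + 2 * (norm (f x) * norm (g x)))"
      using int by simp
    show "(norm ((f + g) x))\<^sup>2 \<le> (norm (f x))\<^sup>2 + (norm (g x))\<^sup>2 + 2 * (norm (f x) * norm (g x))" for x
      using power_mono[OF norm_triangle_ineq[of "f x" "g x"], of 2] by (simp add: power2_sum algebra_simps)
  qed
  also have "\<dots> = (L2_norm f)\<^sup>2 + (L2_norm g)\<^sup>2 + 2 * integral\<^sup>L torus (\<lambda>x. norm (f x) * norm (g x))"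
    using int by (simp add: L2_norm_power2)
  also have "\<dots> \<le> (L2_norm f + L2_norm g)\<^sup>2"
    using L2_norm_product[OF f g] by (simp add: power2_sum)
  finally show "(L2_norm (f + g))\<^sup>2 \<le> (L2_norm f + L2_norm g)\<^sup>2" .
qed simp

lemma L2_norm_triangle_diff:
  assumes "f \<in> L2" "g \<in> L2" "h \<in> L2"
  shows "L2_norm (f - h) \<le> L2_norm (f - g) + L2_norm (g - h)"
  using L2_norm_triangle[of "f - g" "g - h"] assms by (simp add: L2_diff)

lemma L2_inner_add_right:
  assumes "f \<in> L2" "g \<in> L2" "h \<in> L2"
  shows "L2_inner h (f + g) = L2_inner h f + L2_inner h g"
  unfolding L2_inner_def
  by (subst Bochner_Integration.integral_add[symmetric])
    (auto simp: L2_inner_integrable assms algebra_simps sum.distrib)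

lemma L2_inner_self: "L2_inner f f = complex_of_real ((L2_norm f)\<^sup>2)"
  unfolding L2_norm_power2 L2_inner_def integral_complex_of_real[symmetric] norm_vec_def L2_set_def
  by (simp add: sum_nonneg complex_norm_square del: of_real_power)

section \<open>Completeness\<close>

text \<open>Fatou's lemma. The bound is asked only of a tail, because in the proof of completeness
  \<open>u n - u m\<close> is controlled only for \<open>m \<ge> n\<close>.\<close>

lemma L2_of_limit:
  assumes u: "\<And>n. u n \<in> L2" and f: "f \<in> borel_measurable torus"
    and lim: "AE x in torus. (\<lambda>n. u n x) \<longlonglongrightarrow> f x"
    and B: "\<And>m. m \<ge> n \<Longrightarrow> L2_norm (u m) \<le> B"
  shows "f \<in> L2" and "L2_norm f \<le> B"
proof -
  note [measurable] = f L2_measurable[OF u]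
  have "0 \<le> B"
    using B[of n] L2_norm_nonneg[of "u n"] by linarith
  have "(\<integral>\<^sup>+x. ennreal ((norm (f x))\<^sup>2) \<partial>torus) = (\<integral>\<^sup>+x. liminf (\<lambda>n. ennreal ((norm (u n x))\<^sup>2)) \<partial>torus)"
  proof (rule nn_integral_cong_AE)
    show "AE x in torus. ennreal ((norm (f x))\<^sup>2) = liminf (\<lambda>n. ennreal ((norm (u n x))\<^sup>2))"
      using lim
    proof eventually_elim
      case (elim x)
      then have "(\<lambda>n. ennreal ((norm (u n x))\<^sup>2)) \<longlonglongrightarrow> ennreal ((norm (f x))\<^sup>2)"
        by (intro tendsto_intros)
      then show ?case
        using lim_imp_Liminf[OF sequentially_bot] by metis
    qed
  qed
  also have "\<dots> \<le> liminf (\<lambda>n. \<integral>\<^sup>+x. ennreal ((norm (u n x))\<^sup>2) \<partial>torus)"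
    by (rule nn_integral_liminf) simp
  also have "\<dots> \<le> ennreal (B\<^sup>2)"
  proof (rule Liminf_le)
    show "\<forall>\<^sub>F m in sequentially. (\<integral>\<^sup>+x. ennreal ((norm (u m x))\<^sup>2) \<partial>torus) \<le> ennreal (B\<^sup>2)"
      using eventually_ge_at_top[of n]
    proof eventually_elim
      case (elim m)
      have "(\<integral>\<^sup>+x. ennreal ((norm (u m x))\<^sup>2) \<partial>torus) = ennreal ((L2_norm (u m))\<^sup>2)"
        unfolding L2_norm_power2 by (intro nn_integral_eq_integral L2_integrable u) simp
      also have "\<dots> \<le> ennreal (B\<^sup>2)"
        by (intro ennreal_leI power_mono B elim) simp
      finally show ?case .
    qed
  qed simp
  finally have le: "(\<integral>\<^sup>+x. ennreal ((norm (f x))\<^sup>2) \<partial>torus) \<le> ennreal (B\<^sup>2)" .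
  then have int: "integrable torus (\<lambda>x. (norm (f x))\<^sup>2)"
    by (auto simp: integrable_iff_bounded elim!: le_less_trans)
  then show "f \<in> L2"
    by (simp add: L2_def f)
  have "ennreal ((L2_norm f)\<^sup>2) \<le> ennreal (B\<^sup>2)"
    using le nn_integral_eq_integral[OF int] by (simp add: L2_norm_power2)
  then have "(L2_norm f)\<^sup>2 \<le> B\<^sup>2"
    by simp
  then show "L2_norm f \<le> B"
    by (rule power2_le_imp_le) fact
qed

text \<open>Riesz-Fischer for geometric steps: the sum of the increments has finite integral, so the
  telescoping series converges absolutely almost everywhere, and Fatou's lemma turns the pointwise
  limit into a limit in L2.\<close>

lemma L2_complete:
  assumes u: "\<And>n. u n \<in> L2" and K: "\<And>n. L2_norm (u (Suc n) - u n) \<le> K * (1/2) ^ n"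
  shows "\<exists>f\<in>L2. (\<lambda>n. L2_norm (u n - f)) \<longlonglongrightarrow> 0"
proof -
  interpret finite_measure torus by (rule finite_measure_torus)
  note [measurable] = L2_measurable[OF u]
  have "0 \<le> K"
    using order_trans[OF L2_norm_nonneg K[of 0]] by simp
  define d where "d n x = norm (u (Suc n) x - u n x)" for n x
  have [measurable]: "d n \<in> borel_measurable torus" for n
    unfolding d_def by simp
  have d_sq: "integrable torus (\<lambda>x. (d n x)\<^sup>2)" for n
    using L2_integrable[OF L2_diff[OF u u]] by (simp add: d_def)
  have d_int: "integrable torus (d n)" for n
    using square_integrable_imp_integrable[OF _ d_sq] by simp
  have d_le: "integral\<^sup>L torus (d n) \<le> K * (1/2) ^ n" for n
  proof -
    \<comment> \<open>Cauchy-Schwarz against the constant 1, which has norm 1 because the cube has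
      measure 1.\<close>
    have "integral\<^sup>L torus (d n) \<le> L2_norm (u (Suc n) - u n)"
      using Cauchy_Schwarz_integral(2)[of "d n" torus "\<lambda>_. 1"] d_sq measure_torus
      by (simp add: L2_norm_def d_def[abs_def])
    then show ?thesis
      by (rule order_trans[OF _ K])
  qed
  have "(\<integral>\<^sup>+x. (\<Sum>n. ennreal (d n x)) \<partial>torus) = (\<Sum>n. \<integral>\<^sup>+x. ennreal (d n x) \<partial>torus)"
    by (rule nn_integral_suminf) simp
  also have "\<dots> \<le> (\<Sum>n. ennreal (K * (1/2) ^ n))"
  proof (intro suminf_le summableI)
    show "(\<integral>\<^sup>+x. ennreal (d n x) \<partial>torus) \<le> ennreal (K * (1/2) ^ n)" for n
      using d_int d_le by (subst nn_integral_eq_integral) (auto simp: d_def intro: ennreal_leI)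
  qed
  also have "\<dots> = ennreal (\<Sum>n. K * (1/2) ^ n)"
    using \<open>0 \<le> K\<close> by (intro suminf_ennreal2 summable_mult summable_geometric) auto
  finally have "(\<integral>\<^sup>+x. (\<Sum>n. ennreal (d n x)) \<partial>torus) \<noteq> \<infinity>"
    by (auto simp: top_unique)
  then have "AE x in torus. (\<Sum>n. ennreal (d n x)) \<noteq> \<infinity>"
    by (rule nn_integral_PInf_AE[rotated]) simp
  then have lim: "AE x in torus. (\<lambda>n. u n x) \<longlonglongrightarrow> lim (\<lambda>n. u n x)"
  proof eventually_elim
    case (elim x)
    then have "summable (\<lambda>n. d n x)"
      by (intro summable_suminf_not_top) (auto simp: d_def)
    then have "summable (\<lambda>n. u (Suc n) x - u n x)"
      unfolding d_def by (rule summable_norm_cancel)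
    then have "(\<lambda>n. u 0 x + (\<Sum>i<n. u (Suc i) x - u i x)) \<longlonglongrightarrow> u 0 x + (\<Sum>i. u (Suc i) x - u i x)"
      by (intro tendsto_intros summable_LIMSEQ)
    then have "convergent (\<lambda>n. u n x)"
      by (auto simp: sum_lessThan_telescope[of "\<lambda>n. u n x"] convergent_def)
    then show ?case
      by (simp add: convergent_LIMSEQ_iff)
  qed
  \<comment> \<open>On the null set where the sequence diverges \<open>lim\<close> has an
    unspecified value; measurability holds all the same.\<close>
  define f where "f x = lim (\<lambda>n. u n x)" for x
  have f [measurable]: "f \<in> borel_measurable torus"
    unfolding f_def by measurable
  \<comment> \<open>The partial geometric sum is kept exactly; the subtracted term is what lets the
    induction close.\<close>
  have tail: "L2_norm (u (n + k) - u n) \<le> K * (2 * (1/2) ^ n - 2 * (1/2) ^ (n + k))" for n k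
  proof (induction k)
    case (Suc k)
    have "L2_norm (u (n + Suc k) - u n) \<le> L2_norm (u (Suc (n + k)) - u (n + k)) + L2_norm (u (n + k) - u n)"
      using L2_norm_triangle_diff[OF u u u] by simp
    moreover have "K * (2 * (1/2) ^ n - 2 * (1/2) ^ (n + Suc k))
        = K * (2 * (1/2) ^ n - 2 * (1/2) ^ (n + k)) + K * (1/2) ^ (n + k)"
      by (simp add: algebra_simps)
    ultimately show ?case
      using K[of "n + k"] Suc.IH by linarith
  qed (simp add: L2_norm_def)
  have uf: "u n - f \<in> L2 \<and> L2_norm (u n - f) \<le> 2 * K * (1/2) ^ n" for n
  proof -
    have diff: "AE x in torus. (\<lambda>m. (u n - u m) x) \<longlonglongrightarrow> (u n - f) x"
      using lim
    proof eventually_elim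
      case (elim x)
      then show ?case
        unfolding fun_diff_def f_def by (intro tendsto_intros)
    qed
    have bound: "L2_norm (u n - u m) \<le> 2 * K * (1/2) ^ n" if "m \<ge> n" for m
    proof -
      have "0 \<le> K * (1/2) ^ m"
        using \<open>0 \<le> K\<close> by simp
      then show ?thesis
        using tail[of n "m - n"] that
        unfolding L2_norm_minus_commute[of "u n"] by (simp add: right_diff_distrib)
    qed
    have "u n - f \<in> borel_measurable torus"
      unfolding fun_diff_def by measurable
    then show ?thesis
      using L2_of_limit[of "\<lambda>m. u n - u m" "u n - f" n, OF L2_diff[OF u u] _ diff bound] by blast
  qed
  have "u 0 - (u 0 - f) \<in> L2"
    using L2_diff[OF u] uf by blast
  then have "f \<in> L2" by simp
  moreover have "(\<lambda>n. L2_norm (u n - f)) \<longlonglongrightarrow> 0"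
  proof (rule tendsto_sandwich[OF _ _ tendsto_const])
    show "(\<lambda>n. 2 * K * (1/2) ^ n) \<longlonglongrightarrow> 0"
      by (intro tendsto_mult_right_zero LIMSEQ_power_zero) simp
  qed (use uf in auto)
  ultimately show ?thesis by blast
qed

section \<open>Density of trigonometric polynomials\<close>

definition wave :: "int^3 \<Rightarrow> complex^2 \<Rightarrow> sect" where
  "wave b v = (\<lambda>x. \<sigma> b x *s v)"

abbreviation waves :: "sect set" where
  "waves \<equiv> {wave b v | b v. True}"

lemma sigma_0 [simp]: "\<sigma> 0 x = 1"
  by (simp add: \<sigma>_def)

lemma sigma_add: "\<sigma> (b + c) x = \<sigma> b x * \<sigma> c x"
  by (simp add: \<sigma>_def algebra_simps flip: exp_add)

lemma cnj_sigma: "cnj (\<sigma> b x) = \<sigma> (- b) x"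
  by (simp add: \<sigma>_def exp_cnj algebra_simps)

lemma continuous_on_sigma [continuous_intros]: "continuous_on A (\<sigma> b)"
  unfolding \<sigma>_def by (intro continuous_intros)

lemma sigma_axis: "\<sigma> (axis j 1) x = cis (2 * pi * x $ j)"
  using exhaust_3[of j] by (auto simp: \<sigma>_def cis_conv_exp axis_def algebra_simps)

lemma sigma_lattice: "\<sigma> b (x + lattice_vec c) = \<sigma> b x"
proof -
  have "\<sigma> b (x + lattice_vec c) = \<sigma> b x * exp (2 * complex_of_real pi * \<i> *
      of_int (b $ 1 * c $ 1 + b $ 2 * c $ 2 + b $ 3 * c $ 3))"
    by (simp add: \<sigma>_def lattice_vec_def algebra_simps flip: exp_add)
  also have "exp (2 * complex_of_real pi * \<i> * of_int (b $ 1 * c $ 1 + b $ 2 * c $ 2 + b $ 3 * c $ 3)) = 1"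
    by (rule exp_eq_1[THEN iffD2]) (auto intro!: exI[of _ "b $ 1 * c $ 1 + b $ 2 * c $ 2 + b $ 3 * c $ 3"])
  finally show ?thesis by simp
qed

text \<open>No case for scalars is needed: \<open>wave b v\<close> allows every vector
  \<open>v\<close>, so a multiple of a wave is a wave.\<close>

lemma span_waves_induct [consumes 1, case_names zero add wave]:
  assumes "g \<in> sections.span waves" and "P 0"
    and "\<And>f g. P f \<Longrightarrow> P g \<Longrightarrow> P (f + g)" and "\<And>b v. P (wave b v)"
  shows "P g"
  using assms(1)
proof (induction rule: sections.span_induct_alt)
  case base
  then show ?case by (rule assms(2))
next
  case (step c f g)
  then obtain b v where f: "f = wave b v" by auto
  have "section_scale c f = wave b (c *s v)"
    by (simp add: f section_scale_def wave_def fun_eq_iff vec_eq_iff)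
  with step show ?case
    using assms(3)[OF assms(4)] by metis
qed

lemma span_waves_mult_sigma:
  "g \<in> sections.span waves \<Longrightarrow> (\<lambda>x. \<sigma> b x *s g x) \<in> sections.span waves"
proof (induction rule: span_waves_induct)
  case zero
  have "(\<lambda>x. \<sigma> b x *s 0 x) = (0 :: sect)"
    by (simp add: fun_eq_iff)
  then show ?case
    by (simp only: sections.span_zero)
next
  case (add f g)
  have "(\<lambda>x. \<sigma> b x *s (f + g) x) = (\<lambda>x. \<sigma> b x *s f x) + (\<lambda>x. \<sigma> b x *s g x)"
    by (simp add: fun_eq_iff vector_add_ldistrib)
  with add show ?case
    by (simp only: sections.span_add)
next
  case (wave c v)
  have "(\<lambda>x. \<sigma> b x *s wave c v x) = wave (b + c) v"
    by (simp add: wave_def fun_eq_iff sigma_add)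
  then show ?case
    by (auto intro!: sections.span_base)
qed

text \<open>Scalar trigonometric polynomials are recognized by their products with constant vectors,
  so that their algebra is carried out inside the span of the waves.\<close>

definition scalar_trig :: "(real^3 \<Rightarrow> complex) \<Rightarrow> bool" where
  "scalar_trig p \<longleftrightarrow> (\<forall>v. (\<lambda>x. p x *s v) \<in> sections.span waves)"

lemma scalar_trig_add: "scalar_trig p \<Longrightarrow> scalar_trig q \<Longrightarrow> scalar_trig (\<lambda>x. p x + q x)"
  using sections.span_add unfolding scalar_trig_def
  by (fastforce simp: vector_sadd_rdistrib plus_fun_def)

lemma scalar_trig_cmult: "scalar_trig p \<Longrightarrow> scalar_trig (\<lambda>x. c * p x)"
  using sections.span_scale[of _ _ c] unfolding scalar_trig_def
  by (fastforce simp: section_scale_def)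

lemma scalar_trig_sigma: "scalar_trig (\<sigma> b)"
  unfolding scalar_trig_def by (auto intro!: sections.span_base simp flip: wave_def)

lemma scalar_trig_const: "scalar_trig (\<lambda>_. c)"
  using scalar_trig_cmult[OF scalar_trig_sigma[of 0], of c] by simp

lemma scalar_trig_mult:
  assumes p: "scalar_trig p" and q: "scalar_trig q"
  shows "scalar_trig (\<lambda>x. p x * q x)"
proof -
  \<comment> \<open>The product is reached by letting \<open>p\<close> act on whole sections: the
    induction runs over \<open>g\<close>, which is later \<open>q\<close> times a constant
    vector.\<close>
  have "(\<lambda>x. p x *s g x) \<in> sections.span waves" if "g \<in> sections.span waves" for g
    using that
  proof (induction rule: span_waves_induct)
    case zero
    have "(\<lambda>x. p x *s 0 x) = (0 :: sect)"
      by (simp add: fun_eq_iff)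
    then show ?case
      by (simp only: sections.span_zero)
  next
    case (add f g)
    have "(\<lambda>x. p x *s (f + g) x) = (\<lambda>x. p x *s f x) + (\<lambda>x. p x *s g x)"
      by (simp add: fun_eq_iff vector_add_ldistrib)
    with add show ?case
      by (simp only: sections.span_add)
  next
    case (wave c v)
    have "(\<lambda>x. p x *s wave c v x) = (\<lambda>x. \<sigma> c x *s (p x *s v))"
      by (simp add: wave_def fun_eq_iff mult.commute)
    then show ?case
      using span_waves_mult_sigma p by (simp only: scalar_trig_def)
  qed
  then show ?thesis
    using q unfolding scalar_trig_def by fastforce
qed

lemma scalar_trig_sum: "(\<And>i. i \<in> I \<Longrightarrow> scalar_trig (p i)) \<Longrightarrow> scalar_trig (\<lambda>x. \<Sum>i\<in>I. p i x)"
  by (induction I rule: infinite_finite_induct) (auto intro: scalar_trig_const scalar_trig_add)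

section \<open>Uniform approximation on the torus embedded in \<open>complex^3\<close>\<close>

definition torus_embedding :: "real^3 \<Rightarrow> complex^3" where
  "torus_embedding x = (\<chi> j. \<sigma> (axis j 1) x)"

lemma continuous_on_torus_embedding: "continuous_on A torus_embedding"
  unfolding torus_embedding_def by (intro continuous_intros)

lemma scalar_trig_polynomial:
  assumes "real_polynomial_function r"
  shows "scalar_trig (\<lambda>x. complex_of_real (r (torus_embedding x)))"
  using assms
proof (induction rule: real_polynomial_function.induct)
  case (linear L)
  interpret bounded_linear L by fact
  have coord: "scalar_trig (\<lambda>x. complex_of_real (torus_embedding x \<bullet> i))" if i: "i \<in> Basis" for i
  proof -
    obtain j u where u: "i = axis j u" "u = 1 \<or> u = \<i>"
      using i by (auto simp: Basis_vec_def Basis_complex_def)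
    \<comment> \<open>Real and imaginary part are combinations of \<open>z\<close> and
      \<open>cnj z\<close>, and conjugating an exponential negates its frequency.\<close>
    have "complex_of_real (z \<bullet> 1) = 1/2 * z + 1/2 * cnj z"
      "complex_of_real (z \<bullet> \<i>) = - \<i>/2 * z + \<i>/2 * cnj z" for z
      by (auto simp: complex_eq_iff inner_complex_def)
    moreover have "scalar_trig (\<lambda>x. a * \<sigma> (axis j 1) x + c * \<sigma> (- axis j 1) x)" for a c
      by (intro scalar_trig_add scalar_trig_cmult scalar_trig_sigma)
    ultimately show ?thesis
      using u(2) by (auto simp only: u(1) torus_embedding_def inner_axis cnj_sigma vec_lambda_beta)
  qed
  have "L (torus_embedding x) = (\<Sum>i\<in>Basis. (torus_embedding x \<bullet> i) * L i)" for x
    by (subst euclidean_representation[of "torus_embedding x", symmetric]) (simp only: sum scaleR real_scaleR_def)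
  then show ?case
    using coord by (auto simp: mult.commute intro!: scalar_trig_sum scalar_trig_cmult)
next
  case (const c)
  show ?case by (rule scalar_trig_const)
next
  case (add f g)
  then show ?case by (simp add: scalar_trig_add)
next
  case (mult f g)
  then show ?case by (simp add: scalar_trig_mult)
qed

lemma sum_fun_apply: "(\<Sum>i\<in>I. f i) x = (\<Sum>i\<in>I. f i x :: 'b::comm_monoid_add)"
  by (induction I rule: infinite_finite_induct) auto

lemma span_waves_polynomial:
  fixes g :: "complex^3 \<Rightarrow> complex^2"
  assumes "polynomial_function g"
  shows "(\<lambda>x. g (torus_embedding x)) \<in> sections.span waves"
proof -
  have "(\<lambda>x. g (torus_embedding x)) = (\<lambda>x. \<Sum>i\<in>Basis. complex_of_real (g (torus_embedding x) \<bullet> i) *s i)"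
  proof
    fix x
    have "complex_of_real a *s i = a *\<^sub>R i" for a and i :: "complex^2"
      by (simp add: vec_eq_iff complex_eq_iff)
    then show "g (torus_embedding x) = (\<Sum>i\<in>Basis. complex_of_real (g (torus_embedding x) \<bullet> i) *s i)"
      by (simp add: euclidean_representation)
  qed
  also have "\<dots> = (\<Sum>i\<in>Basis. (\<lambda>x. complex_of_real (g (torus_embedding x) \<bullet> i) *s i))"
    by (simp add: fun_eq_iff sum_fun_apply)
  also have "\<dots> \<in> sections.span waves"
  proof (rule sections.span_sum)
    fix i :: "complex^2" assume "i \<in> Basis"
    have "real_polynomial_function (\<lambda>y. g y \<bullet> i)"
      using assms bounded_linear_inner_left unfolding polynomial_function_def o_def by blast
    then show "(\<lambda>x. complex_of_real (g (torus_embedding x) \<bullet> i) *s i) \<in> sections.span waves"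
      using scalar_trig_polynomial unfolding scalar_trig_def by blast
  qed
  finally show ?thesis .
qed

text \<open>Equal exponentials mean integer differences of the coordinates, and within the closed
  unit interval a nonzero integer difference occurs only between 0 and 1. So the map identifies
  distinct points only on the boundary.\<close>

lemma torus_embedding_eqD:
  assumes "torus_embedding x = torus_embedding y" "x \<in> cbox 0 1" "y \<in> cbox 0 1"
  shows "x = y \<or> x \<notin> box 0 1 \<and> y \<notin> box 0 1"
proof -
  have "x $ j = y $ j \<or> x $ j \<in> {0, 1} \<and> y $ j \<in> {0, 1}" for j
  proof -
    have "cis (2 * pi * x $ j) = cis (2 * pi * y $ j)"
      using assms(1) by (simp add: torus_embedding_def vec_eq_iff sigma_axis)
    then obtain n where "2 * pi * x $ j = 2 * pi * y $ j + 2 * pi * of_int n"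
      using sin_cos_eq_iff[of "2 * pi * x $ j" "2 * pi * y $ j"] by (auto simp: complex_eq_iff)
    then have "2 * pi * (x $ j - y $ j - of_int n) = 0"
      by (simp add: algebra_simps)
    then have n: "x $ j - y $ j = of_int n"
      by simp
    have "0 \<le> x $ j" "x $ j \<le> 1" "0 \<le> y $ j" "y $ j \<le> 1"
      using assms(2,3) by (auto simp: mem_box_cart)
    moreover from this n have "-1 \<le> n" "n \<le> 1" by linarith+
    then have "n = -1 \<or> n = 0 \<or> n = 1" by linarith
    ultimately show ?thesis
      using n by auto
  qed
  then have "x = y \<or> (\<exists>j. x $ j \<in> {0, 1} \<and> y $ j \<in> {0, 1})"
    unfolding vec_eq_iff by blast
  moreover have "z \<notin> box 0 1" if "z $ j \<in> {0, 1}" for z :: "real^3" and j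
    using that by (auto simp: mem_box_cart intro!: exI[of _ j])
  ultimately show ?thesis by blast
qed

text \<open>Vanishing on the boundary of the cube makes \<open>f\<close> descend to the embedded torus, where
  the Weierstrass theorem applies; polynomials in the coordinates are trigonometric polynomials.\<close>

lemma span_waves_uniformly_dense:
  fixes f :: sect
  assumes f: "continuous_on (cbox 0 1) f" and 0: "\<And>x. x \<in> cbox 0 1 - box 0 1 \<Longrightarrow> f x = 0"
    and "e > 0"
  shows "\<exists>g\<in>sections.span waves. \<forall>x\<in>cbox 0 1. norm (f x - g x) < e"
proof -
  let ?C = "cbox 0 1 :: (real^3) set" and ?E = torus_embedding
  \<comment> \<open>\<open>inv_into\<close> picks an arbitrary preimage; the choice does not matter,
    since distinct preimages of one point all lie on the boundary, where \<open>f\<close>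
    vanishes.\<close>
  define h where "h y = f (inv_into ?C ?E y)" for y
  have h: "h (?E x) = f x" if "x \<in> ?C" for x
  proof -
    have E: "?E x \<in> ?E ` ?C" using that by simp
    show ?thesis
      using torus_embedding_eqD[OF f_inv_into_f[OF E] inv_into_into[OF E] that] 0 that inv_into_into[OF E]
      by (auto simp: h_def)
  qed
  \<comment> \<open>The chosen preimage need not depend continuously on the point. Instead the graph
    of \<open>h\<close> is the compact image of the cube under \<open>(?E x, f x)\<close>, and a
    closed graph with compact range implies continuity.\<close>
  have "continuous_on (?E ` ?C) h"
  proof (rule continuous_from_closed_graph)
    show "compact (f ` ?C)"
      by (intro compact_continuous_image f) simp
    show "h \<in> ?E ` ?C \<rightarrow> f ` ?C"
      using h by auto
    have "(\<lambda>y. (y, h y)) ` ?E ` ?C = (\<lambda>x. (?E x, f x)) ` ?C"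
      using h by (auto simp: image_iff)
    also have "compact \<dots>"
      by (intro compact_continuous_image continuous_intros f continuous_on_torus_embedding) simp
    finally show "closed ((\<lambda>y. (y, h y)) ` ?E ` ?C)"
      by (rule compact_imp_closed)
  qed
  moreover have "compact (?E ` ?C)"
    by (intro compact_continuous_image continuous_on_torus_embedding) simp
  ultimately obtain g where g: "polynomial_function g" "\<forall>y\<in>?E ` ?C. norm (h y - g y) < e"
    using Stone_Weierstrass_polynomial_function \<open>e > 0\<close> by blast
  show ?thesis
    using span_waves_polynomial[OF g(1)] g(2) h by (intro bexI[of _ "\<lambda>x. g (?E x)"]) auto
qed


section \<open>From uniform approximation to density in L2\<close>

lemma L2_norm_dominated:
  assumes [measurable]: "\<And>n. u n \<in> borel_measurable torus" "f \<in> borel_measurable torus"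
    and lim: "AE x in torus. (\<lambda>n. u n x) \<longlonglongrightarrow> f x"
    and w: "integrable torus (\<lambda>x. (w x)\<^sup>2)" "\<And>n x. x \<in> cbox 0 1 \<Longrightarrow> norm (u n x - f x) \<le> w x"
  shows "(\<lambda>n. L2_norm (u n - f)) \<longlonglongrightarrow> 0"
proof -
  have "(\<lambda>n. integral\<^sup>L torus (\<lambda>x. (norm (u n x - f x))\<^sup>2)) \<longlonglongrightarrow> integral\<^sup>L torus (\<lambda>x. 0)"
  proof (rule integral_dominated_convergence[OF _ _ w(1)])
    show "AE x in torus. (\<lambda>n. (norm (u n x - f x))\<^sup>2) \<longlonglongrightarrow> 0"
      using lim
    proof eventually_elim
      case (elim x)
      then have "(\<lambda>n. (norm (u n x - f x))\<^sup>2) \<longlonglongrightarrow> (norm (f x - f x))\<^sup>2"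
        by (intro tendsto_intros)
      then show ?case by simp
    qed
    show "AE x in torus. norm ((norm (u n x - f x))\<^sup>2) \<le> (w x)\<^sup>2" for n
      by (rule AE_I2) (simp add: power_mono w)
  qed simp_all
  then show ?thesis
    using tendsto_real_sqrt by (fastforce simp: L2_norm_def)
qed

lemma AE_torus_in_box: "AE x in torus. x \<in> box 0 1"
  and AE_torus_not_negligible: "negligible N \<Longrightarrow> AE x in torus. x \<notin> N"
proof -
  show not_in: "AE x in torus. x \<notin> N" if "negligible N" for N
  proof -
    have "AE x in lebesgue. x \<notin> N"
      using that by (intro AE_not_in) (simp add: negligible_iff_null_sets)
    then show ?thesis
      by (subst AE_restrict_space_iff) auto
  qed
  have "negligible (cbox 0 1 - box 0 1 :: (real^3) set)"
    using negligible_frontier_interval .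
  from not_in[OF this] show "AE x in torus. x \<in> box 0 1"
    by (rule AE_mp) (rule AE_I2, simp)
qed

text \<open>A measurable function is an a.e. limit of continuous ones; these are projected to the ball of
  radius \<open>B\<close>, for dominated convergence, and cut off near the boundary of the cube.\<close>

lemma L2_bounded_approx_continuous:
  assumes f: "f \<in> borel_measurable torus" and B: "\<And>x. norm (f x) \<le> B" and e: "e > 0"
  shows "\<exists>g. continuous_on UNIV g \<and> (\<forall>x. x \<notin> box 0 1 \<longrightarrow> g x = 0) \<and> L2_norm (g - f) < e"
proof -
  interpret finite_measure torus by (rule finite_measure_torus)
  let ?K = "- box 0 1 :: (real^3) set"
  have "0 \<le> B"
    using norm_ge_zero B by (rule order_trans)
  have "f measurable_on cbox 0 1"
    using f by (subst measurable_on_iff_borel_measurable) auto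
  then obtain N g where N: "negligible N" and g: "\<And>n. continuous_on UNIV (g n)"
    and lim: "\<And>x. x \<notin> N \<Longrightarrow> (\<lambda>n. g n x) \<longlonglongrightarrow> (if x \<in> cbox 0 1 then f x else 0)"
    unfolding measurable_on_def by blast
  \<comment> \<open>The nearest-point map to a ball is continuous by convexity, and it fixes the
    values of \<open>f\<close>.\<close>
  define p where "p = closest_point (cball (0 :: complex^2) B)"
  have p: "continuous_on UNIV p"
    unfolding p_def using \<open>0 \<le> B\<close> by (intro continuous_on_closest_point) auto
  have p_bound: "norm (p v) \<le> B" for v
    using closest_point_in_set[of "cball (0 :: complex^2) B" v] \<open>0 \<le> B\<close> by (simp add: p_def)
  have p_self: "p (f x) = f x" for x
    unfolding p_def by (rule closest_point_self) (simp add: B)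
  \<comment> \<open>The cut-off is 0 off the open cube and equals 1 at a given interior point for
    all large \<open>n\<close>.\<close>
  define c where "c n x = min 1 (real n * infdist x ?K)" for n x
  \<comment> \<open>The distance to an empty set is 0 by convention, so reading distance 0 as
    membership requires \<open>?K\<close> to be nonempty.\<close>
  have K: "closed ?K" "?K \<noteq> {}"
    by (auto simp: closed_Compl mem_box_cart intro!: exI[of _ 0] simp flip: ex_in_conv)
  have c_cont: "continuous_on UNIV (c n)" for n
    unfolding c_def by (intro continuous_intros)
  have c_bound: "0 \<le> c n x" "c n x \<le> 1" for n x
    by (auto simp: c_def infdist_nonneg)
  have c_lim: "(\<lambda>n. c n x) \<longlonglongrightarrow> 1" if "x \<in> box 0 1" for x
  proof -
    have pos: "infdist x ?K > 0"
      using in_closed_iff_infdist_zero[OF K, of x] that infdist_nonneg[of x ?K] by force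
    then obtain m where "1 < real m * infdist x ?K"
      using reals_Archimedean3 by blast
    then have "c n x = 1" if "n \<ge> m" for n
    proof -
      have "real m * infdist x ?K \<le> real n * infdist x ?K"
        using that pos by (intro mult_right_mono) auto
      with \<open>1 < real m * infdist x ?K\<close> show ?thesis
        by (simp add: c_def)
    qed
    then show ?thesis
      by (intro tendsto_eventually) (auto simp: eventually_sequentially)
  qed
  define k where "k n x = c n x *\<^sub>R p (g n x)" for n x
  have k_cont: "continuous_on UNIV (k n)" for n
    unfolding k_def by (intro continuous_intros c_cont continuous_on_compose2[OF p g]) auto
  have k_zero: "k n x = 0" if "x \<notin> box 0 1" for n x
    using that by (simp add: k_def c_def)
  have "(\<lambda>n. L2_norm (k n - f)) \<longlonglongrightarrow> 0"
  proof (rule L2_norm_dominated[where w = "\<lambda>_. 2 * B"])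
    show "AE x in torus. (\<lambda>n. k n x) \<longlonglongrightarrow> f x"
      using AE_torus_in_box AE_torus_not_negligible[OF N]
    proof eventually_elim
      case (elim x)
      then have "(\<lambda>n. g n x) \<longlonglongrightarrow> f x"
        using lim[of x] box_subset_cbox[of 0 "1 :: real^3"] by auto
      then have "(\<lambda>n. p (g n x)) \<longlonglongrightarrow> p (f x)"
        by (intro continuous_on_tendsto_compose[OF p]) auto
      then have "(\<lambda>n. k n x) \<longlonglongrightarrow> 1 *\<^sub>R p (f x)"
        unfolding k_def by (intro tendsto_intros c_lim elim)
      then show ?case by (simp add: p_self)
    qed
    show "norm (k n x - f x) \<le> 2 * B" for n x
    proof -
      have "norm (k n x) \<le> 1 * B"
        unfolding k_def norm_scaleR using c_bound[of n x] p_bound by (intro mult_mono) auto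
      then show ?thesis
        using norm_triangle_ineq4[of "k n x" "f x"] B[of x] by linarith
    qed
    show "k n \<in> borel_measurable torus" for n
      by (rule L2_measurable, rule L2_continuous) (rule continuous_on_subset[OF k_cont], simp)
  qed (use f in auto)
  then have "\<forall>\<^sub>F n in sequentially. L2_norm (k n - f) < e"
    by (rule order_tendstoD) (rule e)
  then obtain n where "L2_norm (k n - f) < e"
    by (auto simp: eventually_sequentially)
  with k_cont k_zero show ?thesis by blast
qed

lemma L2_norm_le_uniform:
  assumes [measurable]: "f \<in> borel_measurable torus" and B: "\<And>x. x \<in> cbox 0 1 \<Longrightarrow> norm (f x) \<le> B"
  shows "L2_norm f \<le> B"
proof -
  interpret finite_measure torus by (rule finite_measure_torus)
  have "0 \<le> B"
    using order_trans[OF norm_ge_zero B, of 0] by (simp add: mem_box_cart)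
  have "integral\<^sup>L torus (\<lambda>x. (norm (f x))\<^sup>2) \<le> integral\<^sup>L torus (\<lambda>x. B\<^sup>2)"
  proof (rule integral_mono)
    show "integrable torus (\<lambda>x. (norm (f x))\<^sup>2)"
      by (rule L2_integrable, rule L2_bounded[OF assms])
  qed (auto intro!: power_mono B)
  then show ?thesis
    using measure_torus \<open>0 \<le> B\<close> by (simp add: L2_norm_def real_le_lsqrt)
qed

lemma continuous_on_span_waves: "g \<in> sections.span waves \<Longrightarrow> continuous_on A g"
proof (induction rule: span_waves_induct)
  case (wave b v)
  then show ?case
    unfolding wave_def by (intro continuous_intros)
qed (auto simp: zero_fun_def plus_fun_def intro!: continuous_intros)

lemma L2_span_waves: "g \<in> sections.span waves \<Longrightarrow> g \<in> L2"
  by (intro L2_continuous continuous_on_span_waves)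

text \<open>Three approximations share \<open>e\<close>: truncation at height \<open>n\<close>, a
  continuous function vanishing off the open cube, and a trigonometric polynomial uniformly close to
  it. Total measure 1 turns the uniform bound into an L2 bound.\<close>

lemma span_waves_L2_dense:
  assumes h: "h \<in> L2" and "e > 0"
  shows "\<exists>g\<in>sections.span waves. L2_norm (h - g) < e"
proof -
  note [measurable] = L2_measurable[OF h]
  have e: "e / 3 > 0" using \<open>e > 0\<close> by simp
  \<comment> \<open>Large values are replaced by 0, so that the error is at most
    \<open>norm (h x)\<close>, which serves as the dominating function.\<close>
  define f where "f n x = (if norm (h x) \<le> real n then h x else 0)" for n x
  have f [measurable]: "f n \<in> borel_measurable torus" for n
    unfolding f_def by measurable
  have f_bound: "norm (f n x) \<le> real n" for n x
    by (simp add: f_def)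
  have "(\<lambda>n. L2_norm (f n - h)) \<longlonglongrightarrow> 0"
  proof (rule L2_norm_dominated[where w = "\<lambda>x. norm (h x)"])
    show "AE x in torus. (\<lambda>n. f n x) \<longlonglongrightarrow> h x"
    proof (rule AE_I2)
      fix x
      obtain m where "norm (h x) \<le> real m"
        using real_arch_simple by blast
      then have "\<forall>n\<ge>m. f n x = h x"
        by (auto simp: f_def)
      then show "(\<lambda>n. f n x) \<longlonglongrightarrow> h x"
        by (intro tendsto_eventually) (auto simp: eventually_sequentially)
    qed
    show "norm (f n x - h x) \<le> norm (h x)" for n x
      by (simp add: f_def)
  qed (use h in \<open>auto simp: L2_integrable\<close>)
  then have "\<forall>\<^sub>F n in sequentially. L2_norm (f n - h) < e / 3"
    by (rule order_tendstoD) (rule e)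
  then obtain n where n: "L2_norm (f n - h) < e / 3"
    by (auto simp: eventually_sequentially)
  obtain g where g: "continuous_on UNIV g" "\<And>x. x \<notin> box 0 1 \<Longrightarrow> g x = 0" "L2_norm (g - f n) < e / 3"
    using L2_bounded_approx_continuous[OF f f_bound e] by blast
  obtain q where q: "q \<in> sections.span waves" "\<And>x. x \<in> cbox 0 1 \<Longrightarrow> norm (g x - q x) < e / 3"
    using span_waves_uniformly_dense[OF continuous_on_subset[OF g(1)] _ e] g(2) by blast
  have L2: "f n \<in> L2" "g \<in> L2" "q \<in> L2"
    using L2_bounded[OF f f_bound] L2_continuous[OF continuous_on_subset[OF g(1)]] L2_span_waves[OF q(1)]
    by auto
  have "L2_norm (g - q) \<le> e / 3"
    using L2_measurable[OF L2_diff[OF L2(2,3)]] q(2) by (intro L2_norm_le_uniform) (auto intro: less_imp_le)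
  then have "L2_norm (h - q) < e"
    using L2_norm_triangle_diff[OF h L2(1,3)] L2_norm_triangle_diff[OF L2] n g(3)
      L2_norm_minus_commute[of h "f n"] L2_norm_minus_commute[of g "f n"] by linarith
  with q(1) show ?thesis by blast
qed

section \<open>The Dirac operator on trigonometric polynomials\<close>

definition hdot :: "complex^2 \<Rightarrow> complex^2 \<Rightarrow> complex" where
  "hdot v w = (\<Sum>k\<in>UNIV. v $ k * cnj (w $ k))"

text \<open>The matrix by which the Dirac operator acts on the Fourier coefficient of frequency \<open>\<xi>\<close>.\<close>

definition symbol :: "real^3 \<Rightarrow> complex^2 \<Rightarrow> complex^2" where
  "symbol \<xi> v = vector
     [complex_of_real (\<xi> $ 1) * v $ 1 + Complex (\<xi> $ 3) (\<xi> $ 2) * v $ 2,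
      Complex (\<xi> $ 3) (- \<xi> $ 2) * v $ 1 - complex_of_real (\<xi> $ 1) * v $ 2]"

lemma clifford_components:
  "clifford 1 v = vector [- \<i> * v $ 1, \<i> * v $ 2]"
  "clifford 2 v = vector [v $ 2, - v $ 1]"
  "clifford 3 v = vector [- \<i> * v $ 2, - \<i> * v $ 1]"
  by (simp_all add: clifford_def quaternion_simps)

lemma sum_clifford: "(\<Sum>j\<in>UNIV. clifford j ((\<i> * complex_of_real (\<xi> $ j)) *s v)) = symbol \<xi> v"
  by (simp add: sum_3 clifford_components symbol_def vec_eq_iff forall_2 complex_eq_iff)

text \<open>Clifford multiplication acts from the right and the complex structure from the left, so
  associativity of the quaternions makes them commute.\<close>

lemma clifford_scale: "clifford j (c *s v) = c *s clifford j v"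
  using exhaust_3[of j] by (auto simp: clifford_components vec_eq_iff forall_2)

lemma clifford_add: "clifford j (v + w) = clifford j v + clifford j w"
  using exhaust_3[of j] by (auto simp: clifford_components vec_eq_iff forall_2 algebra_simps)

lemma symbol_scale: "symbol \<xi> (c *s v) = c *s symbol \<xi> v"
  by (simp add: symbol_def vec_eq_iff forall_2 algebra_simps)

lemma symbol_add: "symbol \<xi> (v + w) = symbol \<xi> v + symbol \<xi> w"
  by (simp add: symbol_def vec_eq_iff forall_2 algebra_simps)

lemma norm_power2_cart_3: "(norm (\<xi> :: real^3))\<^sup>2 = (\<xi> $ 1)\<^sup>2 + (\<xi> $ 2)\<^sup>2 + (\<xi> $ 3)\<^sup>2"
  by (simp add: norm_vec_def L2_set_def sum_3)

lemma norm_power2_complex_2: "(norm (v :: complex^2))\<^sup>2 = (norm (v $ 1))\<^sup>2 + (norm (v $ 2))\<^sup>2"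
  by (simp add: norm_vec_def L2_set_def sum_2)

text \<open>These are the Clifford relations: the maps \<open>clifford j\<close> anticommute and
  square to -1, and the factors \<open>\<i>\<close> in \<open>sum_clifford\<close> reverse the
  sign.\<close>

lemma symbol_symbol: "symbol \<xi> (symbol \<xi> v) = complex_of_real ((norm \<xi>)\<^sup>2) *s v"
  unfolding norm_power2_cart_3
  by (simp add: symbol_def vec_eq_iff forall_2 complex_eq_iff power2_eq_square algebra_simps)

lemma hdot_symbol: "hdot (symbol \<xi> v) w = hdot v (symbol \<xi> w)"
  by (simp add: hdot_def symbol_def sum_2 complex_eq_iff algebra_simps)

lemma hdot_self: "hdot v v = complex_of_real ((norm v)\<^sup>2)"
  by (simp only: hdot_def norm_power2_complex_2 sum_2 of_real_add complex_norm_square)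

lemma hdot_diff_left: "hdot (v - u) w = hdot v w - hdot u w"
  and hdot_diff_right: "hdot w (v - u) = hdot w v - hdot w u"
  and hdot_scale_left: "hdot (c *s v) w = c * hdot v w"
  and hdot_scale_right: "hdot v (c *s w) = cnj c * hdot v w"
  by (simp_all add: hdot_def sum_2 algebra_simps)

text \<open>A Hermitian map whose square is the scalar \<open>(norm \<xi>)\<^sup>2\<close> is
  \<open>norm \<xi>\<close> times an isometry when \<open>\<xi> \<noteq> 0\<close>.\<close>

lemma norm_symbol: "norm (symbol \<xi> v) = norm \<xi> * norm v"
proof -
  have "complex_of_real ((norm (symbol \<xi> v))\<^sup>2) = complex_of_real ((norm \<xi> * norm v)\<^sup>2)"
    by (simp only: hdot_self[symmetric] hdot_symbol symbol_symbol hdot_scale_right)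
      (simp add: hdot_self power_mult_distrib)
  then show ?thesis
    by (simp only: of_real_eq_iff power2_eq_iff_nonneg norm_ge_zero mult_nonneg_nonneg)
qed

section \<open>Differentiation of waves and of smooth sections\<close>

lemma has_derivative_sigma:
  "(\<sigma> b has_derivative (\<lambda>h. 2 * complex_of_real pi * \<i> *
      (of_int (b $ 1) * complex_of_real (h $ 1) + of_int (b $ 2) * complex_of_real (h $ 2)
        + of_int (b $ 3) * complex_of_real (h $ 3)) * \<sigma> b x)) (at x)"
proof -
  define L where "L h = 2 * complex_of_real pi * \<i> *
      (of_int (b $ 1) * complex_of_real (h $ 1) + of_int (b $ 2) * complex_of_real (h $ 2)
        + of_int (b $ 3) * complex_of_real (h $ 3))" for h :: "real^3"
  have "bounded_linear (\<lambda>x :: real^3. complex_of_real (x $ j))" for j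
    by (rule bounded_linear_compose[OF bounded_linear_of_real bounded_linear_vec_nth])
  then have "bounded_linear L"
    unfolding L_def by (intro bounded_linear_const_mult bounded_linear_add)
  then have "(L has_derivative L) (at x)"
    by (rule bounded_linear_imp_has_derivative)
  moreover have "(exp has_derivative (*) (exp (L x))) (at (L x))"
    using DERIV_exp[of "L x"] by (simp add: has_field_derivative_def)
  ultimately have "((\<lambda>x. exp (L x)) has_derivative (\<lambda>h. exp (L x) * L h)) (at x)"
    by (rule has_derivative_compose)
  then show ?thesis
    by (simp add: L_def \<sigma>_def[abs_def] mult.commute)
qed

lemma bounded_linear_scalar_mult: "bounded_linear (\<lambda>c. c *s (v :: complex^'n))"
  by (auto intro!: linear_conv_bounded_linear[THEN iffD1] linearI simp: vec_eq_iff algebra_simps)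

lemma wave_derivative:
  shows wave_differentiable: "wave b v differentiable (at x)"
    and partial_wave: "partial j (wave b v) = wave b ((2 * complex_of_real pi * \<i> * of_int (b $ j)) *s v)"
proof -
  note deriv = bounded_linear.has_derivative[OF bounded_linear_scalar_mult has_derivative_sigma,
      of b v, folded wave_def]
  then show "wave b v differentiable (at x)"
    unfolding differentiable_def by blast
  show "partial j (wave b v) = wave b ((2 * complex_of_real pi * \<i> * of_int (b $ j)) *s v)"
    unfolding partial_def frechet_derivative_at[OF deriv, symmetric]
    using exhaust_3[of j] by (auto simp: wave_def fun_eq_iff axis_def vec_eq_iff)
qed

text \<open>\<open>frechet_derivative\<close> is a choice that carries information only at points of
  differentiability, hence the two hypotheses.\<close>

lemma partial_add:
  assumes "\<And>x. f differentiable (at x)" "\<And>x. g differentiable (at x)"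
  shows "partial j (f + g) = partial j f + partial j g"
proof
  fix x
  have "((\<lambda>x. f x + g x) has_derivative (\<lambda>h. frechet_derivative f (at x) h + frechet_derivative g (at x) h)) (at x)"
    using assms[of x] unfolding frechet_derivative_works by (rule has_derivative_add)
  from frechet_derivative_at[OF this, symmetric] show "partial j (f + g) x = (partial j f + partial j g) x"
    unfolding partial_def plus_fun_def by simp
qed

text \<open>Partial derivatives stay in the span, which lets the induction for \<open>C_k\<close>
  run to every order.\<close>

lemma span_waves_differentiable:
  assumes "g \<in> sections.span waves"
  shows "(\<forall>x. g differentiable (at x)) \<and> (\<forall>j. partial j g \<in> sections.span waves)"
  using assms
proof (induction rule: span_waves_induct)
  case (wave b v)
  then show ?case
    by (auto simp: partial_wave wave_differentiable intro!: sections.span_base)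
next
  case zero
  have "(0 :: sect) = wave 0 0"
    by (simp add: wave_def fun_eq_iff)
  then show ?case
    using wave_differentiable[of 0 0] partial_wave[of _ 0 0] sections.span_base[of _ waves]
    by (metis (mono_tags, lifting) mem_Collect_eq)
next
  case (add f g)
  then have "(f + g) differentiable (at x)" for x
    unfolding plus_fun_def by (intro differentiable_add) auto
  with add show ?case
    by (simp add: partial_add sections.span_add del: plus_fun_apply)
qed

lemma span_waves_smooth: "g \<in> sections.span waves \<Longrightarrow> g \<in> smooth_sections"
proof -
  have "C_k k g" if "g \<in> sections.span waves" for k g
    using that
  proof (induction k arbitrary: g)
    case 0
    then show ?case by (simp add: continuous_on_span_waves)
  next
    case (Suc k)
    then show ?case using span_waves_differentiable by simp
  qed
  moreover have "g (x + lattice_vec b) = g x" if "g \<in> sections.span waves" for g x b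
    using that by (induction rule: span_waves_induct) (auto simp: wave_def sigma_lattice)
  ultimately show "g \<in> sections.span waves \<Longrightarrow> g \<in> smooth_sections"
    by (auto simp: smooth_sections_def)
qed

lemma smooth_sectionsD:
  assumes "u \<in> smooth_sections"
  shows smooth_differentiable: "u differentiable (at x)"
    and smooth_continuous: "continuous_on A u"
    and smooth_partial_continuous: "continuous_on A (partial j u)"
    and smooth_periodic: "u (x + lattice_vec b) = u x"
proof -
  have C: "C_k 0 u" "C_k (Suc 0) u"
    using assms unfolding smooth_sections_def by blast+
  show "u differentiable (at x)"
    using C(2) by simp
  show "continuous_on A u" "continuous_on A (partial j u)"
    using C by (auto intro: continuous_on_subset)
  show "u (x + lattice_vec b) = u x"
    using assms unfolding smooth_sections_def by blast
qed

lemma smooth_partial_periodic: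
  assumes "u \<in> smooth_sections"
  shows "partial j u (x + lattice_vec b) = partial j u x"
proof -
  have "(u has_derivative frechet_derivative u (at (x + lattice_vec b))) (at (x + lattice_vec b))"
    using smooth_differentiable[OF assms] by (simp add: frechet_derivative_works)
  moreover have "((\<lambda>x. x + lattice_vec b) has_derivative (\<lambda>h. h)) (at x)"
    by (auto intro!: derivative_eq_intros)
  ultimately have "(u \<circ> (\<lambda>x. x + lattice_vec b) has_derivative
      frechet_derivative u (at (x + lattice_vec b)) \<circ> (\<lambda>h. h)) (at x)"
    by (intro diff_chain_at) auto
  then have "(u has_derivative frechet_derivative u (at (x + lattice_vec b))) (at x)"
    by (simp add: o_def smooth_periodic[OF assms])
  from frechet_derivative_at[OF this] show ?thesis
    by (simp add: partial_def)
qed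

lemma Dirac_add:
  assumes "\<And>x. f differentiable (at x)" "\<And>x. g differentiable (at x)"
  shows "Dirac \<alpha> (f + g) = Dirac \<alpha> f + Dirac \<alpha> g"
  by (simp add: Dirac_def partial_add[OF assms] fun_eq_iff clifford_add vector_add_ldistrib
      sum.distrib add_ac)

text \<open>The derivative in direction \<open>j\<close> contributes
  \<open>2 * pi * \<i> * b $ j\<close> and the connection \<open>\<i> * \<alpha> $ j\<close>; their
  sum is \<open>\<i>\<close> times the component of \<open>\<beta> b \<alpha>\<close>.\<close>

lemma Dirac_wave: "Dirac \<alpha> (wave b v) = wave b (symbol (\<beta> b \<alpha>) v)"
proof
  fix x
  have "clifford j (partial j (wave b v) x + (\<i> * complex_of_real (\<alpha> $ j)) *s wave b v x)
      = \<sigma> b x *s clifford j ((\<i> * complex_of_real (\<beta> b \<alpha> $ j)) *s v)" for j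
    unfolding clifford_scale[symmetric]
    by (rule arg_cong[where f = "clifford j"])
      (simp add: partial_wave, simp add: wave_def \<beta>_def lattice_vec_def vec_eq_iff algebra_simps)
  then have "Dirac \<alpha> (wave b v) x = (\<Sum>j\<in>UNIV. \<sigma> b x *s clifford j ((\<i> * complex_of_real (\<beta> b \<alpha> $ j)) *s v))"
    by (simp add: Dirac_def)
  also have "\<dots> = wave b (symbol (\<beta> b \<alpha>) v) x"
    unfolding sum_clifford[symmetric] wave_def by (simp add: vec_eq_iff sum_distrib_left)
  finally show "Dirac \<alpha> (wave b v) x = wave b (symbol (\<beta> b \<alpha>) v) x" .
qed

lemma wave_simps:
  "wave b v + wave b w = wave b (v + w)"
  "wave b v - wave b w = wave b (v - w)"
  "section_scale c (wave b v) = wave b (c *s v)"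
  "wave b 0 = 0"
  by (simp_all add: wave_def section_scale_def fun_eq_iff vec_eq_iff algebra_simps)

lemma span_waves_sum:
  assumes "g \<in> sections.span waves"
  obtains F v where "finite F" "g = (\<Sum>b\<in>F. wave b (v b))"
proof -
  have "\<exists>F v. finite F \<and> g = (\<Sum>b\<in>F. wave b (v b))"
    using assms
  proof (induction rule: span_waves_induct)
    case zero
    then show ?case by (intro exI[of _ "{}"]) simp
  next
    case (wave b v)
    then show ?case by (intro exI[of _ "{b}"] exI[of _ "\<lambda>_. v"]) simp
  next
    case (add f g)
    then obtain F v G w where FG: "finite F" "finite G"
      and fg: "f = (\<Sum>b\<in>F. wave b (v b))" "g = (\<Sum>b\<in>G. wave b (w b))" by blast
    \<comment> \<open>Coefficients are extended by 0 so that both sums run over the same frequencies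
      and add termwise.\<close>
    have eqs: "(\<Sum>b\<in>F. wave b (v b)) = (\<Sum>b\<in>F \<union> G. wave b (if b \<in> F then v b else 0))"
      "(\<Sum>b\<in>G. wave b (w b)) = (\<Sum>b\<in>F \<union> G. wave b (if b \<in> G then w b else 0))"
      using FG by (auto intro!: sum.mono_neutral_cong_left simp: wave_simps)
    have "f + g = (\<Sum>b\<in>F \<union> G. wave b ((if b \<in> F then v b else 0) + (if b \<in> G then w b else 0)))"
      unfolding fg eqs by (simp only: sum.distrib wave_simps(1)[symmetric])
    moreover have "finite (F \<union> G)"
      using FG by simp
    ultimately show ?case
      by (intro exI conjI)
  qed
  with that show thesis by blast
qed

lemma wave_in_span: "wave b v \<in> sections.span waves"
  by (auto intro: sections.span_base)

lemma Dirac_sum_waves: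
  "Dirac \<alpha> (\<Sum>b\<in>F. wave b (v b)) = (\<Sum>b\<in>F. wave b (symbol (\<beta> b \<alpha>) (v b)))"
proof (induction F rule: infinite_finite_induct)
  case (insert b F)
  have "(\<Sum>b\<in>F. wave b (v b)) \<in> sections.span waves"
    by (intro sections.span_sum wave_in_span)
  then show ?case
    using insert span_waves_differentiable by (simp add: Dirac_add wave_differentiable Dirac_wave del: plus_fun_apply)
next
  \<comment> \<open>A sum over an infinite set is 0, so this settles the infinite case together with
    the empty one.\<close>
  have "Dirac \<alpha> (0 :: sect) = 0"
    using Dirac_wave[of \<alpha> 0 0] by (simp add: wave_simps symbol_def) (simp add: wave_def fun_eq_iff vec_eq_iff forall_2)
  then show "Dirac \<alpha> (\<Sum>b\<in>{}. wave b (v b)) = (\<Sum>b\<in>{}. wave b (symbol (\<beta> b \<alpha>) (v b)))"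
    and "infinite A \<Longrightarrow> Dirac \<alpha> (\<Sum>b\<in>A. wave b (v b)) = (\<Sum>b\<in>A. wave b (symbol (\<beta> b \<alpha>) (v b)))" for A
    by simp_all
qed

section \<open>Fourier coefficients\<close>

definition fourier_coeff :: "sect \<Rightarrow> int^3 \<Rightarrow> complex^2" where
  "fourier_coeff f b = (\<chi> k. integral\<^sup>L torus (\<lambda>x. f x $ k * cnj (\<sigma> b x)))"

lemma line_derivative:
  fixes f :: "real^3 \<Rightarrow> 'b::real_normed_vector"
  assumes "f differentiable (at (x + t *\<^sub>R e))"
  shows "((\<lambda>t. f (x + t *\<^sub>R e)) has_vector_derivative frechet_derivative f (at (x + t *\<^sub>R e)) e) (at t)"
proof -
  have f: "(f has_derivative frechet_derivative f (at (x + t *\<^sub>R e))) (at (x + t *\<^sub>R e))"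
    using assms by (simp add: frechet_derivative_works)
  have "((\<lambda>t. x + t *\<^sub>R e) has_derivative (\<lambda>h. h *\<^sub>R e)) (at t)"
    by (auto intro!: derivative_eq_intros)
  from has_derivative_compose[OF this f] show ?thesis
    using linear_scale[OF has_derivative_linear[OF f]] by (simp add: has_vector_derivative_def)
qed

lemma line_derivative_sigma:
  "((\<lambda>t. \<sigma> b (x + t *\<^sub>R axis j 1)) has_vector_derivative
    2 * complex_of_real pi * \<i> * of_int (b $ j) * \<sigma> b (x + t *\<^sub>R axis j 1)) (at t)"
proof -
  have "\<sigma> b differentiable (at y)" for y
    using has_derivative_sigma by (auto simp: differentiable_def)
  moreover have "frechet_derivative (\<sigma> b) (at y) (axis j 1)
      = 2 * complex_of_real pi * \<i> * of_int (b $ j) * \<sigma> b y" for y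
    unfolding frechet_derivative_at[OF has_derivative_sigma, symmetric]
    using exhaust_3[of j] by (auto simp: axis_def)
  ultimately show ?thesis
    using line_derivative[of "\<sigma> b" x t "axis j 1"] by simp
qed

lemma axis_lattice_vec: "axis j 1 = lattice_vec (axis j 1)"
  by (simp add: lattice_vec_def axis_def vec_eq_iff)

lemma integral_torus_continuous:
  fixes g :: "real^3 \<Rightarrow> 'b::euclidean_space"
  assumes "continuous_on UNIV g"
  shows "integral\<^sup>L torus g = integral (cbox 0 1) g"
  by (intro lebesgue_integral_eq_integral continuous_imp_integrable continuous_on_subset[OF assms]) auto

text \<open>If \<open>b $ j \<noteq> 0\<close>, then \<open>\<sigma> b\<close> is up to a nonzero
  factor its own derivative in direction \<open>j\<close>, and the integral of a periodic derivative
  vanishes.\<close>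

lemma integral_sigma: "integral\<^sup>L torus (\<sigma> b) = (if b = 0 then 1 else 0)"
proof (cases "b = 0")
  case True
  then have "\<sigma> b = (\<lambda>_. 1)" by auto
  with True show ?thesis
    using measure_torus by simp
next
  case False
  then obtain j where j: "b $ j \<noteq> 0"
    by (auto simp: vec_eq_iff)
  have "integral (cbox 0 1) (\<lambda>x. 2 * complex_of_real pi * \<i> * of_int (b $ j) * \<sigma> b x) = 0"
    by (rule integral_cube_derivative_eq_0[OF line_derivative_sigma])
      (auto simp: axis_lattice_vec sigma_lattice intro!: continuous_intros)
  then show ?thesis
    using j False by (simp add: integral_torus_continuous continuous_on_sigma)
qed

lemma integrable_fourier:
  assumes "f \<in> L2"
  shows "integrable torus (\<lambda>x. f x $ k * cnj (\<sigma> b x))"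
proof -
  have "integrable torus (\<lambda>x. \<Sum>i\<in>UNIV. f x $ i * cnj (wave b (axis k 1) x $ i))"
    by (intro L2_inner_integrable assms L2_span_waves wave_in_span)
  also have "(\<lambda>x. \<Sum>i\<in>UNIV. f x $ i * cnj (wave b (axis k 1) x $ i)) = (\<lambda>x. f x $ k * cnj (\<sigma> b x))"
    using exhaust_2[of k] by (auto simp: wave_def sum_2 axis_def)
  finally show ?thesis .
qed

lemma L2_inner_wave:
  assumes "f \<in> L2"
  shows "L2_inner f (wave b v) = hdot (fourier_coeff f b) v"
proof -
  have "L2_inner f (wave b v) = integral\<^sup>L torus (\<lambda>x. \<Sum>k\<in>UNIV. f x $ k * cnj (\<sigma> b x) * cnj (v $ k))"
    by (simp add: L2_inner_def wave_def mult.assoc)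
  also have "\<dots> = hdot (fourier_coeff f b) v"
    using integrable_fourier[OF assms] by (simp add: hdot_def fourier_coeff_def)
  finally show ?thesis .
qed

lemma fourier_coeff_wave: "fourier_coeff (wave b v) c = (if b = c then v else 0)"
proof -
  have "\<sigma> b x * v $ k * cnj (\<sigma> c x) = \<sigma> (b - c) x * v $ k" for x k
    using sigma_add[of b "- c" x] by (simp add: cnj_sigma)
  then have "integral\<^sup>L torus (\<lambda>x. \<sigma> b x * v $ k * cnj (\<sigma> c x)) = (if b = c then v $ k else 0)" for k
    by (simp only: integral_mult_left_zero integral_sigma) simp
  then show ?thesis
    by (simp add: fourier_coeff_def wave_def) (simp add: vec_eq_iff)
qed

lemma L2_inner_waves: "L2_inner (wave b v) (wave c w) = (if b = c then hdot v w else 0)"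
  by (subst L2_inner_wave) (auto intro!: L2_span_waves wave_in_span simp: fourier_coeff_wave hdot_def)

lemma fourier_coeff_add:
  assumes "f \<in> L2" "g \<in> L2"
  shows "fourier_coeff (f + g) b = fourier_coeff f b + fourier_coeff g b"
  using integrable_fourier[OF assms(1)] integrable_fourier[OF assms(2)]
  by (simp add: fourier_coeff_def vec_eq_iff algebra_simps)

lemma fourier_coeff_scale: "fourier_coeff (section_scale c f) b = c *s fourier_coeff f b"
  by (simp add: fourier_coeff_def vec_eq_iff section_scale_def mult.assoc)

lemma fourier_coeff_clifford:
  assumes "f \<in> L2"
  shows "fourier_coeff (\<lambda>x. clifford j (f x)) b = clifford j (fourier_coeff f b)"
  using exhaust_3[of j] by (auto simp: clifford_components fourier_coeff_def vec_eq_iff forall_2 mult.assoc)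

text \<open>Integration by parts without boundary term: \<open>?g\<close> is the derivative of the
  periodic product of a component of \<open>u\<close> with
  \<open>cnj (\<sigma> b x)\<close>.\<close>

lemma fourier_coeff_partial:
  assumes u: "u \<in> smooth_sections"
  shows "fourier_coeff (partial j u) b = (2 * complex_of_real pi * \<i> * of_int (b $ j)) *s fourier_coeff u b"
proof -
  let ?c = "2 * complex_of_real pi * \<i> * of_int (b $ j)"
  have L2: "u \<in> L2" "partial j u \<in> L2"
    by (auto intro!: L2_continuous smooth_continuous smooth_partial_continuous u)
  have "integral\<^sup>L torus (\<lambda>x. partial j u x $ k * cnj (\<sigma> b x) - ?c * (u x $ k * cnj (\<sigma> b x))) = 0" for k
  proof -
    let ?g = "\<lambda>x. u x $ k * (- ?c * cnj (\<sigma> b x)) + partial j u x $ k * cnj (\<sigma> b x)"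
    have "integral (cbox 0 1) ?g = 0"
    proof (rule integral_cube_derivative_eq_0)
      fix x t
      have "((\<lambda>t. cnj (\<sigma> b (x + t *\<^sub>R axis j 1))) has_vector_derivative
          - ?c * cnj (\<sigma> b (x + t *\<^sub>R axis j 1))) (at t)"
        using line_derivative_sigma[of "- b"] by (simp add: cnj_sigma)
      moreover have "((\<lambda>t. u (x + t *\<^sub>R axis j 1) $ k) has_vector_derivative
          partial j u (x + t *\<^sub>R axis j 1) $ k) (at t)"
        unfolding partial_def
        by (intro bounded_linear.has_vector_derivative[OF bounded_linear_vec_nth] line_derivative
            smooth_differentiable u)
      ultimately show "((\<lambda>t. u (x + t *\<^sub>R axis j 1) $ k * cnj (\<sigma> b (x + t *\<^sub>R axis j 1)))
          has_vector_derivative ?g (x + t *\<^sub>R axis j 1)) (at t)"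
        by (intro has_vector_derivative_mult)
    next
      show "continuous_on UNIV ?g"
        by (intro continuous_intros smooth_continuous smooth_partial_continuous u)
    qed (simp_all add: axis_lattice_vec smooth_periodic[OF u] smooth_partial_periodic[OF u] sigma_lattice)
    moreover have "continuous_on UNIV ?g"
      by (intro continuous_intros smooth_continuous smooth_partial_continuous u)
    ultimately show ?thesis
      using integral_torus_continuous[of ?g] by (simp add: algebra_simps)
  qed
  then show ?thesis
    using integrable_fourier[OF L2(1)] integrable_fourier[OF L2(2)]
    by (simp add: fourier_coeff_def vec_eq_iff)
qed

lemma continuous_on_clifford [continuous_intros]:
  "continuous_on A f \<Longrightarrow> continuous_on A (\<lambda>x. clifford j (f x))"
  by (rule continuous_on_compose2[of UNIV "clifford j"])
    (auto intro!: linear_continuous_on linear_conv_bounded_linear[THEN iffD1] linearI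
      simp: clifford_add clifford_def qmult_def vec_eq_iff forall_2 algebra_simps)

lemma Dirac_continuous:
  assumes "u \<in> smooth_sections"
  shows "continuous_on A (Dirac \<alpha> u)"
  unfolding Dirac_def
  by (intro continuous_intros smooth_continuous smooth_partial_continuous assms)

text \<open>Extends \<open>Dirac_wave\<close> to all smooth sections, one coefficient at a time and
  without summing a Fourier series.\<close>

lemma fourier_coeff_Dirac:
  assumes u: "u \<in> smooth_sections"
  shows "fourier_coeff (Dirac \<alpha> u) b = symbol (\<beta> b \<alpha>) (fourier_coeff u b)"
proof -
  define w where "w j = partial j u + section_scale (\<i> * complex_of_real (\<alpha> $ j)) u" for j
  have L2: "u \<in> L2" "partial j u \<in> L2" for j
    by (auto intro!: L2_continuous smooth_continuous smooth_partial_continuous u)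
  have w: "w j \<in> L2" "continuous_on A (w j)" for j A
    unfolding w_def section_scale_def plus_fun_def
    by (intro L2_continuous continuous_intros smooth_continuous[OF u] smooth_partial_continuous[OF u])+
  have coeff_w: "fourier_coeff (w j) b = (\<i> * complex_of_real (\<beta> b \<alpha> $ j)) *s fourier_coeff u b" for j
    unfolding w_def
    by (subst fourier_coeff_add) (auto simp: L2 L2_scale fourier_coeff_partial[OF u] fourier_coeff_scale
        \<beta>_def lattice_vec_def vec_eq_iff algebra_simps)
  have "(\<lambda>x. clifford j (w j x)) \<in> L2" for j
    by (intro L2_continuous continuous_intros w)
  moreover have "Dirac \<alpha> u = (\<lambda>x. clifford 1 (w 1 x)) + (\<lambda>x. clifford 2 (w 2 x)) + (\<lambda>x. clifford 3 (w 3 x))"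
    by (simp add: Dirac_def w_def section_scale_def sum_3 fun_eq_iff)
  ultimately have "fourier_coeff (Dirac \<alpha> u) b = (\<Sum>j\<in>UNIV. clifford j (fourier_coeff (w j) b))"
    by (simp add: fourier_coeff_add L2_add fourier_coeff_clifford w sum_3 del: plus_fun_apply)
  then show ?thesis
    by (simp only: coeff_w sum_clifford)
qed

section \<open>The resolvent estimate\<close>

lemma L2_sum_waves: "(\<Sum>b\<in>F. wave b (v b)) \<in> L2"
  by (intro L2_span_waves sections.span_sum wave_in_span)

lemma L2_wave: "wave b v \<in> L2"
  by (intro L2_span_waves wave_in_span)

lemma fourier_coeff_0 [simp]: "fourier_coeff 0 c = 0"
  by (simp add: fourier_coeff_def vec_eq_iff)

lemma fourier_coeff_sum_waves:
  assumes "finite F"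
  shows "fourier_coeff (\<Sum>b\<in>F. wave b (v b)) c = (if c \<in> F then v c else 0)"
  using assms
proof (induction F rule: finite_induct)
  case (insert b F)
  then show ?case
    by (auto simp: fourier_coeff_add L2_sum_waves L2_wave fourier_coeff_wave simp del: plus_fun_apply)
qed (simp del: zero_fun_apply)

lemma L2_inner_sum_waves:
  assumes "f \<in> L2"
  shows "L2_inner f (\<Sum>b\<in>F. wave b (v b)) = (\<Sum>b\<in>F. hdot (fourier_coeff f b) (v b))"
proof (induction F rule: infinite_finite_induct)
  case (insert b F)
  then show ?case
    by (simp add: L2_inner_add_right assms L2_sum_waves L2_wave L2_inner_wave del: plus_fun_apply)
qed (simp_all add: L2_inner_def)

text \<open>Parseval's identity for finite sums, by orthogonality of different frequencies; it turns
  bounds on the blocks into bounds in L2.\<close>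

lemma L2_norm_sum_waves:
  assumes "finite F"
  shows "(L2_norm (\<Sum>b\<in>F. wave b (v b)))\<^sup>2 = (\<Sum>b\<in>F. (norm (v b))\<^sup>2)"
proof -
  have "complex_of_real ((L2_norm (\<Sum>b\<in>F. wave b (v b)))\<^sup>2) = (\<Sum>b\<in>F. hdot (v b) (v b))"
    unfolding L2_inner_self[symmetric] L2_inner_sum_waves[OF L2_sum_waves]
    by (rule sum.cong) (auto simp: fourier_coeff_sum_waves assms)
  also have "\<dots> = complex_of_real (\<Sum>b\<in>F. (norm (v b))\<^sup>2)"
    by (simp only: hdot_self of_real_sum)
  finally show ?thesis
    by (simp only: of_real_eq_iff)
qed

lemma L2_norm_wave: "L2_norm (wave b v) = norm v"
  using L2_norm_sum_waves[of "{b}" "\<lambda>_. v"] by simp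

section \<open>Resolvents of the blocks and their uniform bound\<close>

definition symbol_resolvent :: "complex \<Rightarrow> real^3 \<Rightarrow> complex^2 \<Rightarrow> complex^2" where
  "symbol_resolvent \<mu> \<xi> v = inverse (complex_of_real ((norm \<xi>)\<^sup>2) - \<mu>\<^sup>2) *s (symbol \<xi> v + \<mu> *s v)"

lemma symbol_resolvent:
  assumes "complex_of_real ((norm \<xi>)\<^sup>2) \<noteq> \<mu>\<^sup>2"
  shows "symbol \<xi> (symbol_resolvent \<mu> \<xi> v) - \<mu> *s symbol_resolvent \<mu> \<xi> v = v"
proof -
  let ?d = "complex_of_real ((norm \<xi>)\<^sup>2) - \<mu>\<^sup>2"
  have "symbol \<xi> (symbol_resolvent \<mu> \<xi> v) - \<mu> *s symbol_resolvent \<mu> \<xi> v = inverse ?d *s (?d *s v)"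
    unfolding symbol_resolvent_def symbol_scale symbol_add symbol_symbol
    by (simp only: vec_eq_iff vector_minus_component vector_add_component vector_smult_component)
      (simp add: algebra_simps power2_eq_square)
  also have "\<dots> = v"
  proof -
    have "inverse ?d * ?d = 1"
      using assms by (intro left_inverse) (simp only: right_minus_eq not_False_eq_True)
    then show ?thesis
      by (simp only: vector_smult_assoc vector_smult_lid)
  qed
  finally show ?thesis .
qed

text \<open>The numerator \<open>S + \<mu>\<close> has operator norm at most
  \<open>norm \<xi> + norm \<mu>\<close>; the first hypothesis bounds the quotient by the
  denominator, written without division.\<close>

lemma norm_symbol_resolvent:
  assumes "norm \<xi> + norm \<mu> \<le> C * norm (complex_of_real ((norm \<xi>)\<^sup>2) - \<mu>\<^sup>2)"
    and "complex_of_real ((norm \<xi>)\<^sup>2) \<noteq> \<mu>\<^sup>2"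
  shows "norm (symbol_resolvent \<mu> \<xi> v) \<le> C * norm v"
proof -
  let ?d = "complex_of_real ((norm \<xi>)\<^sup>2) - \<mu>\<^sup>2"
  have d: "0 < norm ?d"
    using assms(2) by simp
  have "norm (symbol \<xi> v + \<mu> *s v) \<le> (norm \<xi> + norm \<mu>) * norm v"
    using norm_triangle_ineq[of "symbol \<xi> v" "\<mu> *s v"]
    by (simp add: norm_symbol norm_vector_scalar_mult algebra_simps)
  also have "\<dots> \<le> C * norm ?d * norm v"
    by (intro mult_right_mono assms) simp
  finally have "inverse (norm ?d) * norm (symbol \<xi> v + \<mu> *s v) \<le> inverse (norm ?d) * (C * norm ?d * norm v)"
    by (intro mult_left_mono) auto
  also have "\<dots> = C * norm v"
    using d by (simp add: field_simps)
  finally show ?thesis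
    by (simp only: symbol_resolvent_def norm_vector_scalar_mult norm_inverse)
qed

text \<open>Each coordinate satisfies
  \<open>2 * pi * \<bar>b $ j\<bar> \<le> r + norm \<alpha>\<close>, which confines \<open>b\<close>
  to a finite box of integer vectors.\<close>

lemma finite_beta_bounded: "finite {b. norm (\<beta> b \<alpha>) \<le> r}"
proof -
  let ?I = "{- \<lceil>r + norm \<alpha>\<rceil>..\<lceil>r + norm \<alpha>\<rceil>}"
  have "b $ j \<in> ?I" if "norm (\<beta> b \<alpha>) \<le> r" for b j
  proof -
    have "\<bar>2 * pi * of_int (b $ j)\<bar> \<le> \<bar>\<beta> b \<alpha> $ j\<bar> + \<bar>\<alpha> $ j\<bar>"
      by (simp add: \<beta>_def lattice_vec_def)
    also have "\<dots> \<le> r + norm \<alpha>"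
      using component_le_norm_cart[of "\<beta> b \<alpha>" j] component_le_norm_cart[of \<alpha> j] that by linarith
    finally have "2 * pi * \<bar>of_int (b $ j)\<bar> \<le> r + norm \<alpha>"
      by (simp add: abs_mult)
    moreover have "1 * \<bar>of_int (b $ j)\<bar> \<le> 2 * pi * \<bar>real_of_int (b $ j)\<bar>"
      using pi_gt3 by (intro mult_right_mono) auto
    ultimately have "\<bar>of_int (b $ j)\<bar> \<le> r + norm \<alpha>" by linarith
    then have "\<bar>b $ j\<bar> \<le> \<lceil>r + norm \<alpha>\<rceil>"
      by linarith
    then show ?thesis by auto
  qed
  then have "{b. norm (\<beta> b \<alpha>) \<le> r} \<subseteq> vec_lambda ` (UNIV \<rightarrow>\<^sub>E ?I)"
    by (auto intro!: image_eqI[of _ vec_lambda "($) _"] simp: PiE_UNIV_domain)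
  then show ?thesis
    by (rule finite_subset) (intro finite_imageI finite_PiE; simp)
qed

lemma symbol_resolvent_bound:
  assumes "\<And>b. complex_of_real ((norm (\<beta> b \<alpha>))\<^sup>2) \<noteq> \<mu>\<^sup>2"
  obtains C where "C \<ge> 0"
    and "\<And>b. norm (\<beta> b \<alpha>) + norm \<mu> \<le> C * norm (complex_of_real ((norm (\<beta> b \<alpha>))\<^sup>2) - \<mu>\<^sup>2)"
proof -
  \<comment> \<open>Outside \<open>F\<close> the difference
    \<open>norm (\<beta> b \<alpha>) - norm \<mu>\<close> exceeds 1, so the denominator dominates
    the numerator and the quotient is at most 1. The constant \<open>C\<close> adds to this 1 the
    finitely many quotients inside \<open>F\<close>.\<close>
  define F where "F = {b. norm (\<beta> b \<alpha>) \<le> norm \<mu> + 1}"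
  define d where "d b = norm (complex_of_real ((norm (\<beta> b \<alpha>))\<^sup>2) - \<mu>\<^sup>2)" for b
  define q where "q b = (norm (\<beta> b \<alpha>) + norm \<mu>) / d b" for b
  define C where "C = 1 + sum q F"
  have "finite F"
    unfolding F_def by (rule finite_beta_bounded)
  have d: "d b > 0" for b
    using assms[of b] by (simp add: d_def)
  have q: "q b \<ge> 0" for b
    by (simp add: q_def d_def)
  have C: "C \<ge> 1"
    using q by (simp add: C_def sum_nonneg)
  have "norm (\<beta> b \<alpha>) + norm \<mu> \<le> C * d b" for b
  proof (cases "b \<in> F")
    case True
    have "q b \<le> C"
      using member_le_sum[OF True, of q] q \<open>finite F\<close> by (simp add: C_def)
    then show ?thesis
      using d[of b] by (simp add: q_def field_simps)
  next
    case False
    then have "1 * (norm (\<beta> b \<alpha>) + norm \<mu>) \<le> (norm (\<beta> b \<alpha>) - norm \<mu>) * (norm (\<beta> b \<alpha>) + norm \<mu>)"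
      by (intro mult_right_mono) (auto simp: F_def)
    also have "\<dots> = norm (complex_of_real ((norm (\<beta> b \<alpha>))\<^sup>2)) - norm (\<mu>\<^sup>2)"
      by (simp add: norm_power norm_mult power2_eq_square algebra_simps)
    also have "\<dots> \<le> 1 * d b"
      unfolding d_def by (simp only: norm_triangle_ineq2 mult_1)
    also have "\<dots> \<le> C * d b"
      using C d[of b] by (intro mult_right_mono) auto
    finally show ?thesis by simp
  qed
  with C show thesis
    by (intro that[of C]) (auto simp: d_def)
qed

lemma fourier_coeff_Dirac_shift:
  assumes u: "u \<in> smooth_sections"
  shows "Dirac \<alpha> u - section_scale \<mu> u \<in> L2"
    and "fourier_coeff (Dirac \<alpha> u - section_scale \<mu> u) b
      = symbol (\<beta> b \<alpha>) (fourier_coeff u b) - \<mu> *s fourier_coeff u b"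
proof -
  have L2: "Dirac \<alpha> u \<in> L2" "u \<in> L2"
    by (intro L2_continuous Dirac_continuous[OF u] smooth_continuous[OF u])+
  then show "Dirac \<alpha> u - section_scale \<mu> u \<in> L2"
    by (intro L2_diff L2_scale)
  have "Dirac \<alpha> u - section_scale \<mu> u = Dirac \<alpha> u + section_scale (- \<mu>) u"
    by (simp add: fun_eq_iff section_scale_def vec_eq_iff)
  then have "fourier_coeff (Dirac \<alpha> u - section_scale \<mu> u) b
      = fourier_coeff (Dirac \<alpha> u) b + (- \<mu>) *s fourier_coeff u b"
    using fourier_coeff_add[OF L2(1) L2_scale[OF L2(2)]] by (simp only: fourier_coeff_scale)
  then show "fourier_coeff (Dirac \<alpha> u - section_scale \<mu> u) b
      = symbol (\<beta> b \<alpha>) (fourier_coeff u b) - \<mu> *s fourier_coeff u b"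
    by (simp add: fourier_coeff_Dirac[OF u] vec_eq_iff)
qed

text \<open>The constant is the one of the blocks: testing against a finite sum involves only
  finitely many of them, all bounded by \<open>C\<close>, so nothing is lost in passing to arbitrary
  smooth \<open>u\<close>.\<close>

lemma Dirac_lower_bound_smooth:
  assumes \<mu>: "\<And>b. complex_of_real ((norm (\<beta> b \<alpha>))\<^sup>2) \<noteq> \<mu>\<^sup>2"
    and C: "C \<ge> 0" "\<And>b. norm (\<beta> b \<alpha>) + norm \<mu> \<le> C * norm (complex_of_real ((norm (\<beta> b \<alpha>))\<^sup>2) - \<mu>\<^sup>2)"
    and u: "u \<in> smooth_sections"
  shows "L2_norm u \<le> C * L2_norm (Dirac \<alpha> u - section_scale \<mu> u)"
proof -
  let ?N = "Dirac \<alpha> u - section_scale \<mu> u"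
  have u_L2: "u \<in> L2"
    by (intro L2_continuous smooth_continuous u)
  \<comment> \<open>The denominators of the dual problem are the conjugates of the original ones, so
    they are nonzero and obey the same bound.\<close>
  have cnj_d: "complex_of_real ((norm (\<beta> b \<alpha>))\<^sup>2) - (cnj \<mu>)\<^sup>2 = cnj (complex_of_real ((norm (\<beta> b \<alpha>))\<^sup>2) - \<mu>\<^sup>2)" for b
    by simp
  have \<mu>': "complex_of_real ((norm (\<beta> b \<alpha>))\<^sup>2) \<noteq> (cnj \<mu>)\<^sup>2" for b
    using \<mu>[of b] cnj_d[of b] by (metis complex_cnj_zero_iff eq_iff_diff_eq_0)
  have C': "norm (\<beta> b \<alpha>) + norm (cnj \<mu>) \<le> C * norm (complex_of_real ((norm (\<beta> b \<alpha>))\<^sup>2) - (cnj \<mu>)\<^sup>2)" for b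
    unfolding cnj_d complex_mod_cnj by (rule C)
  have dual: "norm (L2_inner u p) \<le> C * L2_norm ?N * L2_norm p" if p: "p \<in> sections.span waves" for p
  proof -
    obtain F v where F: "finite F" and p: "p = (\<Sum>b\<in>F. wave b (v b))"
      using p by (rule span_waves_sum)
    define w where "w b = symbol_resolvent (cnj \<mu>) (\<beta> b \<alpha>) (v b)" for b
    define q where "q = (\<Sum>b\<in>F. wave b (w b))"
    have v: "v b = symbol (\<beta> b \<alpha>) (w b) - cnj \<mu> *s w b" for b
      unfolding w_def by (rule symbol_resolvent[symmetric]) (rule \<mu>')
    \<comment> \<open>The symbol is Hermitian and \<open>hdot\<close> is conjugate linear on the
      right, so \<open>- cnj \<mu>\<close> on the right becomes \<open>- \<mu>\<close> on the
      left.\<close>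
    have "hdot (fourier_coeff u b) (v b) = hdot (fourier_coeff ?N b) (w b)" for b
      unfolding v fourier_coeff_Dirac_shift(2)[OF u] hdot_diff_left hdot_diff_right hdot_scale_left
        hdot_scale_right hdot_symbol by simp
    then have "L2_inner u p = L2_inner ?N q"
      by (simp add: p q_def L2_inner_sum_waves u_L2 fourier_coeff_Dirac_shift(1)[OF u] del: minus_apply)
    moreover have "L2_norm q \<le> C * L2_norm p"
    proof (rule power2_le_imp_le)
      have "(\<Sum>b\<in>F. (norm (w b))\<^sup>2) \<le> (\<Sum>b\<in>F. (C * norm (v b))\<^sup>2)"
        unfolding w_def by (intro sum_mono power_mono norm_symbol_resolvent C' \<mu>') simp
      then show "(L2_norm q)\<^sup>2 \<le> (C * L2_norm p)\<^sup>2"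
        by (simp add: p q_def L2_norm_sum_waves[OF F] power_mult_distrib sum_distrib_left)
    qed (simp add: C)
    moreover have "q \<in> L2"
      unfolding q_def by (rule L2_sum_waves)
    ultimately have "norm (L2_inner u p) \<le> L2_norm ?N * (C * L2_norm p)"
      using order_trans[OF Cauchy_Schwarz_L2[OF fourier_coeff_Dirac_shift(1)[OF u]]
          mult_left_mono[OF _ L2_norm_nonneg]] by metis
    then show ?thesis by (simp add: mult_ac)
  qed
  \<comment> \<open>Testing \<open>u\<close> against a polynomial \<open>p\<close> near
    \<open>u\<close> itself recovers its squared norm up to errors that vanish with
    \<open>e\<close>; a factor \<open>L2_norm u\<close> is cancelled at the end.\<close>
  have "(L2_norm u)\<^sup>2 \<le> C * L2_norm ?N * (L2_norm u + e) + L2_norm u * e" if e: "e > 0" for e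
  proof -
    obtain p where p: "p \<in> sections.span waves" "L2_norm (u - p) < e"
      using span_waves_L2_dense[OF u_L2 e] by blast
    note p_L2 = L2_span_waves[OF p(1)]
    have "complex_of_real ((L2_norm u)\<^sup>2) = L2_inner u p + L2_inner u (u - p)"
      using L2_inner_add_right[OF p_L2 L2_diff[OF u_L2 p_L2] u_L2] by (simp add: L2_inner_self)
    then have "(L2_norm u)\<^sup>2 \<le> norm (L2_inner u p) + norm (L2_inner u (u - p))"
      by (metis norm_triangle_ineq norm_of_real abs_power2)
    also have "\<dots> \<le> C * L2_norm ?N * L2_norm p + L2_norm u * L2_norm (u - p)"
      by (intro add_mono dual p Cauchy_Schwarz_L2 u_L2 L2_diff p_L2)
    also have "\<dots> \<le> C * L2_norm ?N * (L2_norm u + e) + L2_norm u * e"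
    proof (intro add_mono mult_left_mono)
      show "L2_norm p \<le> L2_norm u + e"
        using L2_norm_triangle[OF u_L2 L2_diff[OF p_L2 u_L2]] p(2) L2_norm_minus_commute[of p u] by simp
    qed (use p(2) C in auto)
    finally show ?thesis .
  qed
  then have "\<forall>\<^sub>F e in at_right 0. (L2_norm u)\<^sup>2 \<le> C * L2_norm ?N * (L2_norm u + e) + L2_norm u * e"
    by (intro eventually_mono[OF eventually_at_right_less])
  moreover have "((\<lambda>e. C * L2_norm ?N * (L2_norm u + e) + L2_norm u * e)
      \<longlongrightarrow> C * L2_norm ?N * (L2_norm u + 0) + L2_norm u * 0) (at_right 0)"
    by (intro tendsto_intros)
  ultimately have "(L2_norm u)\<^sup>2 \<le> C * L2_norm ?N * (L2_norm u + 0) + L2_norm u * 0"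
    by (intro tendsto_lowerbound) auto
  then have "L2_norm u * L2_norm u \<le> (C * L2_norm ?N) * L2_norm u"
    by (simp add: power2_eq_square)
  then show ?thesis
    using L2_norm_nonneg[of u] mult_nonneg_nonneg[OF C(1) L2_norm_nonneg[of ?N]]
    by (cases "L2_norm u = 0") (auto simp del: L2_norm_nonneg)
qed

lemma Dirac_shift_surj_span_waves:
  assumes \<mu>: "\<And>b. complex_of_real ((norm (\<beta> b \<alpha>))\<^sup>2) \<noteq> \<mu>\<^sup>2" and h: "h \<in> sections.span waves"
  shows "\<exists>u\<in>sections.span waves. Dirac \<alpha> u - section_scale \<mu> u = h"
proof -
  obtain F v where h: "h = (\<Sum>b\<in>F. wave b (v b))"
    using h by (rule span_waves_sum)
  define w where "w b = symbol_resolvent \<mu> (\<beta> b \<alpha>) (v b)" for b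
  have v: "v b = symbol (\<beta> b \<alpha>) (w b) - \<mu> *s w b" for b
    unfolding w_def by (rule symbol_resolvent[symmetric]) (rule \<mu>)
  have "Dirac \<alpha> (\<Sum>b\<in>F. wave b (w b)) - section_scale \<mu> (\<Sum>b\<in>F. wave b (w b)) = h"
    unfolding h Dirac_sum_waves sections.scale_sum_right v wave_simps(2)[symmetric] wave_simps(3)
    by (simp only: sum_subtractf)
  moreover have "(\<Sum>b\<in>F. wave b (w b)) \<in> sections.span waves"
    by (intro sections.span_sum wave_in_span)
  ultimately show ?thesis by blast
qed

section \<open>Spectrum and eigenbasis\<close>

text \<open>Both sides of the bound pass to the limit along the sequence that witnesses membership
  in the graph; \<open>?r\<close> is the bound with all error terms still visible.\<close>

lemma Dirac_lower_bound_closure: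
  assumes bound: "\<And>u. u \<in> smooth_sections \<Longrightarrow> L2_norm u \<le> C * L2_norm (Dirac \<alpha> u - section_scale \<mu> u)"
    and C: "C \<ge> 0" and fg: "(f, g) \<in> closure_graph (Dirac \<alpha>)"
  shows "L2_norm f \<le> C * L2_norm (g - section_scale \<mu> f)"
proof -
  obtain u where u: "\<And>n. u n \<in> smooth_sections"
    and lim: "(\<lambda>n. L2_norm (u n - f)) \<longlonglongrightarrow> 0" "(\<lambda>n. L2_norm (Dirac \<alpha> (u n) - g)) \<longlonglongrightarrow> 0"
    and fg: "f \<in> L2" "g \<in> L2"
    using fg unfolding closure_graph_def by blast
  have u_L2: "u n \<in> L2" and Du_L2: "Dirac \<alpha> (u n) \<in> L2" for n
    by (intro L2_continuous smooth_continuous[OF u] Dirac_continuous[OF u])+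
  let ?r = "\<lambda>n. L2_norm (u n - f) + C * (L2_norm (Dirac \<alpha> (u n) - g) + L2_norm (g - section_scale \<mu> f) + norm \<mu> * L2_norm (u n - f))"
  have "?r \<longlonglongrightarrow> 0 + C * (0 + L2_norm (g - section_scale \<mu> f) + norm \<mu> * 0)"
    by (intro tendsto_intros lim)
  moreover have "L2_norm f \<le> ?r n" for n
  proof -
    have "Dirac \<alpha> (u n) - section_scale \<mu> (u n)
        = (Dirac \<alpha> (u n) - g) + ((g - section_scale \<mu> f) + section_scale \<mu> (f - u n))"
      by (simp add: fun_eq_iff section_scale_def vec_eq_iff algebra_simps)
    then have "L2_norm (Dirac \<alpha> (u n) - section_scale \<mu> (u n))
        \<le> L2_norm (Dirac \<alpha> (u n) - g) + L2_norm ((g - section_scale \<mu> f) + section_scale \<mu> (f - u n))"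
      using L2_norm_triangle[of "Dirac \<alpha> (u n) - g" "(g - section_scale \<mu> f) + section_scale \<mu> (f - u n)"]
      by (simp only: L2_diff L2_add L2_scale fg u_L2 Du_L2)
    also have "\<dots> \<le> L2_norm (Dirac \<alpha> (u n) - g) + (L2_norm (g - section_scale \<mu> f) + norm \<mu> * L2_norm (f - u n))"
      using L2_norm_triangle[of "g - section_scale \<mu> f" "section_scale \<mu> (f - u n)"]
      by (simp only: L2_diff L2_scale fg u_L2 L2_norm_scale add_left_mono)
    finally have "L2_norm (u n) \<le> C * (L2_norm (Dirac \<alpha> (u n) - g) + L2_norm (g - section_scale \<mu> f) + norm \<mu> * L2_norm (f - u n))"
      using order_trans[OF bound[OF u] mult_left_mono[OF _ C]] by (simp only: add.assoc)
    moreover have "L2_norm f \<le> L2_norm (f - u n) + L2_norm (u n)"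
      using L2_norm_triangle[OF L2_diff[OF fg(1) u_L2] u_L2, of n n] by simp
    ultimately show ?thesis
      unfolding L2_norm_minus_commute[of f] by linarith
  qed
  ultimately have "L2_norm f \<le> 0 + C * (0 + L2_norm (g - section_scale \<mu> f) + norm \<mu> * 0)"
    by (intro LIMSEQ_le_const) auto
  then show ?thesis by simp
qed

lemma Dirac_resolvent_set:
  assumes \<mu>: "\<And>b. complex_of_real ((norm (\<beta> b \<alpha>))\<^sup>2) \<noteq> \<mu>\<^sup>2"
  shows "\<mu> \<in> resolvent_set (Dirac \<alpha>)"
proof -
  obtain C where C: "C \<ge> 0"
    "\<And>b. norm (\<beta> b \<alpha>) + norm \<mu> \<le> C * norm (complex_of_real ((norm (\<beta> b \<alpha>))\<^sup>2) - \<mu>\<^sup>2)"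
    using symbol_resolvent_bound[OF \<mu>] by blast
  note smooth_bound = Dirac_lower_bound_smooth[OF \<mu> C]
  have surj: "\<exists>(f, g)\<in>closure_graph (Dirac \<alpha>). AE x in torus. (g - section_scale \<mu> f) x = h x" if h: "h \<in> L2" for h
  proof -
    \<comment> \<open>The rate \<open>(1/2) ^ n\<close> provides the geometric steps that
      \<open>L2_complete\<close> asks for.\<close>
    have ex: "\<exists>u\<in>sections.span waves. L2_norm (h - (Dirac \<alpha> u - section_scale \<mu> u)) < (1/2) ^ n" for n :: nat
    proof -
      obtain q where q: "q \<in> sections.span waves" "L2_norm (h - q) < (1/2) ^ n"
        using span_waves_L2_dense[OF h, of "(1/2) ^ n"] by auto
      obtain u where u: "u \<in> sections.span waves" "Dirac \<alpha> u - section_scale \<mu> u = q"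
        using Dirac_shift_surj_span_waves[OF \<mu> q(1)] by blast
      show ?thesis
        using q(2) unfolding u(2)[symmetric] by (intro bexI[of _ u] u(1))
    qed
    have "\<exists>u. \<forall>n. u n \<in> sections.span waves
        \<and> L2_norm (h - (Dirac \<alpha> (u n) - section_scale \<mu> (u n))) < (1/2) ^ n"
      by (rule choice) (use ex in blast)
    then obtain u where u: "\<And>n. u n \<in> sections.span waves"
      and hu: "\<And>n. L2_norm (h - (Dirac \<alpha> (u n) - section_scale \<mu> (u n))) < (1/2) ^ n"
      by blast
    let ?S = "\<lambda>n. Dirac \<alpha> (u n) - section_scale \<mu> (u n)"
    have smooth: "u n \<in> smooth_sections" for n
      by (rule span_waves_smooth) (rule u)
    have u_L2: "u n \<in> L2" and S_L2: "?S n \<in> L2" and Du_L2: "Dirac \<alpha> (u n) \<in> L2" for n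
      by (intro L2_span_waves u fourier_coeff_Dirac_shift(1) smooth L2_continuous Dirac_continuous)+
    \<comment> \<open>Consecutive images are within \<open>(1/2) ^ Suc n + (1/2) ^ n\<close> of each
      other, at most twice \<open>(1/2) ^ n\<close>; the lower bound contributes the factor
      \<open>C\<close>.\<close>
    have step: "L2_norm (u (Suc n) - u n) \<le> (2 * C) * (1/2) ^ n" for n
    proof -
      have diff: "u (Suc n) - u n \<in> sections.span waves"
        by (intro sections.span_diff u)
      have "Dirac \<alpha> (u (Suc n)) = Dirac \<alpha> (u (Suc n) - u n) + Dirac \<alpha> (u n)"
        using Dirac_add[of "u (Suc n) - u n" "u n" \<alpha>] span_waves_differentiable[OF diff] span_waves_differentiable[OF u]
        by (simp only: diff_add_cancel)
      then have eq: "Dirac \<alpha> (u (Suc n) - u n) - section_scale \<mu> (u (Suc n) - u n) = ?S (Suc n) - ?S n"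
        by (simp add: sections.scale_right_diff_distrib del: plus_fun_apply minus_apply)
      have "L2_norm (?S (Suc n) - ?S n) \<le> L2_norm (?S (Suc n) - h) + L2_norm (h - ?S n)"
        by (intro L2_norm_triangle_diff S_L2 h)
      also have "\<dots> \<le> (1/2) ^ Suc n + (1/2) ^ n"
        using hu[of "Suc n"] hu[of n] L2_norm_minus_commute[of h "?S (Suc n)"] by linarith
      also have "\<dots> \<le> 2 * (1/2) ^ n"
        by simp
      finally have "C * L2_norm (?S (Suc n) - ?S n) \<le> C * (2 * (1/2) ^ n)"
        by (rule mult_left_mono) (rule C)
      with smooth_bound[OF span_waves_smooth[OF diff], unfolded eq] show ?thesis
        by linarith
    qed
    obtain f where f: "f \<in> L2" and lim: "(\<lambda>n. L2_norm (u n - f)) \<longlonglongrightarrow> 0"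
      using L2_complete[OF u_L2 step] by blast
    \<comment> \<open>Chosen so that \<open>?g - section_scale \<mu> f\<close> equals
      \<open>h\<close> at every point, not only almost everywhere.\<close>
    let ?g = "h + section_scale \<mu> f"
    have "(\<lambda>n. L2_norm (Dirac \<alpha> (u n) - ?g)) \<longlonglongrightarrow> 0"
    proof (rule tendsto_sandwich[OF _ _ tendsto_const])
      show "\<forall>\<^sub>F n in sequentially. L2_norm (Dirac \<alpha> (u n) - ?g) \<le> (1/2) ^ n + norm \<mu> * L2_norm (u n - f)"
      proof (rule always_eventually, rule allI)
        fix n
        have "Dirac \<alpha> (u n) - ?g = (?S n - h) + section_scale \<mu> (u n - f)"
          by (simp add: fun_eq_iff section_scale_def vec_eq_iff algebra_simps)
        then have "L2_norm (Dirac \<alpha> (u n) - ?g) \<le> L2_norm (?S n - h) + norm \<mu> * L2_norm (u n - f)"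
          using L2_norm_triangle[OF L2_diff[OF S_L2 h] L2_scale[OF L2_diff[OF u_L2 f]], of n \<mu> n]
          by (simp only: L2_norm_scale)
        then show "L2_norm (Dirac \<alpha> (u n) - ?g) \<le> (1/2) ^ n + norm \<mu> * L2_norm (u n - f)"
          using hu[of n] L2_norm_minus_commute[of h "?S n"] by linarith
      qed
      have "(\<lambda>n. (1/2) ^ n + norm \<mu> * L2_norm (u n - f)) \<longlonglongrightarrow> 0 + norm \<mu> * 0"
        by (intro tendsto_intros lim LIMSEQ_power_zero) simp
      then show "(\<lambda>n. (1/2) ^ n + norm \<mu> * L2_norm (u n - f)) \<longlonglongrightarrow> 0" by simp
    qed simp
    with lim smooth f h have "(f, ?g) \<in> closure_graph (Dirac \<alpha>)"
      unfolding closure_graph_def by (auto intro!: L2_add L2_scale simp del: plus_fun_apply minus_apply)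
    then show ?thesis
      by (intro bexI[of _ "(f, ?g)"]) auto
  qed
  show ?thesis
    unfolding resolvent_set_def
    using surj Dirac_lower_bound_closure[OF smooth_bound C(1)] by blast
qed

text \<open>An eigensection makes the right side of the resolvent estimate 0 whatever the constant,
  while its own norm is positive.\<close>

lemma eigenvalue_in_spectrum:
  assumes "symbol (\<beta> b \<alpha>) v = \<mu> *s v" "v \<noteq> 0"
  shows "\<mu> \<in> spectrum (Dirac \<alpha>)"
proof -
  have "Dirac \<alpha> (wave b v) = section_scale \<mu> (wave b v)"
    by (simp add: Dirac_wave assms wave_simps)
  then have "(wave b v, section_scale \<mu> (wave b v)) \<in> closure_graph (Dirac \<alpha>)"
    unfolding closure_graph_def
    by (auto intro!: L2_scale L2_wave exI[of _ "\<lambda>_. wave b v"] span_waves_smooth wave_in_span simp: L2_norm_def)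
  moreover have "\<not> L2_norm (wave b v) \<le> C * L2_norm (section_scale \<mu> (wave b v) - section_scale \<mu> (wave b v))" for C
    using assms(2) by (simp add: L2_norm_wave) (simp add: L2_norm_def)
  ultimately show ?thesis
    unfolding spectrum_def resolvent_set_def by fast
qed

text \<open>Since \<open>(S - \<mu>) (S + \<mu>) = 0\<close>, every nonzero value of
  \<open>S + \<mu>\<close> is an eigenvector. If there is none, then \<open>S\<close> is the scalar
  \<open>- \<mu>\<close>; as \<open>S\<close> has trace 0, \<open>\<mu>\<close> is 0 and every
  vector is in the kernel.\<close>

lemma symbol_eigenvector_exists:
  assumes "\<mu>\<^sup>2 = complex_of_real ((norm \<xi>)\<^sup>2)"
  shows "\<exists>v. v \<noteq> 0 \<and> symbol \<xi> v = \<mu> *s v"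
proof (cases "\<exists>e. symbol \<xi> e + \<mu> *s e \<noteq> 0")
  case True
  then obtain e where "symbol \<xi> e + \<mu> *s e \<noteq> 0" by blast
  moreover have "symbol \<xi> (symbol \<xi> e + \<mu> *s e) = \<mu> *s (symbol \<xi> e + \<mu> *s e)"
    unfolding symbol_add symbol_scale symbol_symbol assms[symmetric]
    by (simp add: vec_eq_iff algebra_simps power2_eq_square)
  ultimately show ?thesis by blast
next
  case False
  then have "symbol \<xi> e + \<mu> *s e = 0" for e by blast
  from this[of "vector [1, 0]"] this[of "vector [0, 1]"] have \<mu>: "\<mu> = 0"
    by (auto simp: symbol_def vec_eq_iff forall_2)
  with False show ?thesis
    by (intro exI[of _ "vector [1, 0]"]) (auto simp: vec_eq_iff forall_2)
qed

lemma spectrum_Dirac: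
  "spectrum (Dirac \<alpha>) = (\<Union>b. {complex_of_real (norm (\<beta> b \<alpha>)), - complex_of_real (norm (\<beta> b \<alpha>))})"
proof -
  have "\<mu> \<in> spectrum (Dirac \<alpha>) \<longleftrightarrow> (\<exists>b. \<mu>\<^sup>2 = complex_of_real ((norm (\<beta> b \<alpha>))\<^sup>2))" for \<mu>
    using symbol_eigenvector_exists eigenvalue_in_spectrum Dirac_resolvent_set[of \<alpha> \<mu>]
    unfolding spectrum_def by (metis ComplD)
  \<comment> \<open>Squares treat the two signs together up to this point; here they
    separate.\<close>
  moreover have "\<mu>\<^sup>2 = complex_of_real (r\<^sup>2) \<longleftrightarrow> \<mu> = complex_of_real r \<or> \<mu> = - complex_of_real r" for \<mu> r
    by (simp add: power2_eq_iff)
  ultimately show ?thesis by auto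
qed

section \<open>The explicit eigensections\<close>

abbreviation e_plus :: "complex^2" where "e_plus \<equiv> vector [1, 0]"
abbreviation e_minus :: "complex^2" where "e_minus \<equiv> vector [0, 1]"

lemma sigma_pm_wave: "\<sigma>_plus b = wave b e_plus" "\<sigma>_minus b = wave b e_minus"
  by (auto simp: \<sigma>_plus_def \<sigma>_minus_def wave_def fun_eq_iff vec_eq_iff forall_2)

lemma eigensections_wave:
  "section_scale c (\<sigma>_plus b) - Dirac \<alpha> (\<sigma>_plus b) = wave b (c *s e_plus - symbol (\<beta> b \<alpha>) e_plus)"
  "section_scale c (\<sigma>_plus b) + Dirac \<alpha> (\<sigma>_plus b) = wave b (c *s e_plus + symbol (\<beta> b \<alpha>) e_plus)"
  by (simp_all only: sigma_pm_wave Dirac_wave wave_simps)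

lemma wave_in_span_pm: "wave b v \<in> sections.span {\<sigma>_plus b, \<sigma>_minus b}"
proof -
  have "wave b v = section_scale (v $ 1) (\<sigma>_plus b) + section_scale (v $ 2) (\<sigma>_minus b)"
    unfolding sigma_pm_wave wave_simps by (rule arg_cong[where f = "wave b"]) (simp add: vec_eq_iff forall_2)
  then show ?thesis
    by (simp only:) (intro sections.span_add sections.span_scale sections.span_base; simp)
qed

lemma span_eigensections:
  assumes "\<beta> b \<alpha> $ 2 \<noteq> 0 \<or> \<beta> b \<alpha> $ 3 \<noteq> 0"
  shows "sections.span {\<sigma>_plus b, \<sigma>_minus b} = sections.span
        {section_scale (complex_of_real (norm (\<beta> b \<alpha>))) (\<sigma>_plus b) - Dirac \<alpha> (\<sigma>_plus b),
         section_scale (complex_of_real (norm (\<beta> b \<alpha>))) (\<sigma>_plus b) + Dirac \<alpha> (\<sigma>_plus b)}" (is "_ = sections.span {?m, ?p}")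
proof -
  let ?r = "complex_of_real (norm (\<beta> b \<alpha>))"
  \<comment> \<open>\<open>z\<close> is the lower left entry of the symbol, that is the
    \<open>e_minus\<close> component of its value at \<open>e_plus\<close>; it is nonzero exactly
    under the assumption.\<close>
  define z where "z = Complex (\<beta> b \<alpha> $ 3) (- \<beta> b \<alpha> $ 2)"
  have z: "z \<noteq> 0"
    using assms by (auto simp: z_def complex_eq_iff)
  have r: "?r \<noteq> 0"
    using assms by auto
  have plus: "\<sigma>_plus b = section_scale (1 / (2 * ?r)) (?m + ?p)"
    unfolding eigensections_wave unfolding sigma_pm_wave wave_simps
    using r by (intro arg_cong[where f = "wave b"]) (simp add: vec_eq_iff forall_2)
  \<comment> \<open>Half of \<open>?p - ?m\<close> is
    \<open>Dirac \<alpha> (\<sigma>_plus b)\<close>, which equals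
    \<open>\<beta> b \<alpha> $ 1\<close> times \<open>\<sigma>_plus b\<close> plus \<open>z\<close>
    times \<open>\<sigma>_minus b\<close>; this is solved for the last term.\<close>
  have minus: "\<sigma>_minus b = section_scale (1 / z) (section_scale (1/2) (?p - ?m) - section_scale (complex_of_real (\<beta> b \<alpha> $ 1)) (\<sigma>_plus b))"
    unfolding eigensections_wave unfolding sigma_pm_wave wave_simps
    using z by (intro arg_cong[where f = "wave b"]) (simp add: vec_eq_iff forall_2 symbol_def z_def)
  have base: "?m \<in> sections.span {?m, ?p}" "?p \<in> sections.span {?m, ?p}"
    by (rule sections.span_base, simp)+
  have p: "\<sigma>_plus b \<in> sections.span {?m, ?p}"
    by (subst plus) (intro sections.span_scale sections.span_add base)
  moreover have "\<sigma>_minus b \<in> sections.span {?m, ?p}"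
    by (subst minus) (intro sections.span_scale sections.span_diff base p)
  moreover have "?m \<in> sections.span {\<sigma>_plus b, \<sigma>_minus b}" "?p \<in> sections.span {\<sigma>_plus b, \<sigma>_minus b}"
    unfolding eigensections_wave by (rule wave_in_span_pm)+
  ultimately show ?thesis
    unfolding sections.span_eq by simp
qed

theorem theorem11:
  fixes \<alpha> :: "real^3"
  shows "orthogonal_eigenbasis (Dirac \<alpha>)
      ({section_scale (complex_of_real (norm (\<beta> b \<alpha>))) (\<sigma>_plus b) - Dirac \<alpha> (\<sigma>_plus b) | b.
          \<beta> b \<alpha> $ 2 \<noteq> 0 \<or> \<beta> b \<alpha> $ 3 \<noteq> 0} \<union>
       {section_scale (complex_of_real (norm (\<beta> b \<alpha>))) (\<sigma>_plus b) + Dirac \<alpha> (\<sigma>_plus b) | b.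
          \<beta> b \<alpha> $ 2 \<noteq> 0 \<or> \<beta> b \<alpha> $ 3 \<noteq> 0} \<union>
       (\<Union>b\<in>{b. \<beta> b \<alpha> $ 2 = 0 \<and> \<beta> b \<alpha> $ 3 = 0}. {\<sigma>_plus b, \<sigma>_minus b})) \<and>
    (\<forall>b. \<beta> b \<alpha> $ 2 \<noteq> 0 \<or> \<beta> b \<alpha> $ 3 \<noteq> 0 \<longrightarrow>
      sections.span {\<sigma>_plus b, \<sigma>_minus b} =
      sections.span
        {section_scale (complex_of_real (norm (\<beta> b \<alpha>))) (\<sigma>_plus b) - Dirac \<alpha> (\<sigma>_plus b),
         section_scale (complex_of_real (norm (\<beta> b \<alpha>))) (\<sigma>_plus b) + Dirac \<alpha> (\<sigma>_plus b)}) \<and>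
    spectrum (Dirac \<alpha>) =
      (\<Union>b. {complex_of_real (norm (\<beta> b \<alpha>)), - complex_of_real (norm (\<beta> b \<alpha>))})"
    (is "orthogonal_eigenbasis _ ?E \<and> _ \<and> _")
proof (intro conjI allI impI span_eigensections spectrum_Dirac)
  define good where "good b \<longleftrightarrow> \<beta> b \<alpha> $ 2 \<noteq> 0 \<or> \<beta> b \<alpha> $ 3 \<noteq> 0" for b
  define m where "m b = complex_of_real (norm (\<beta> b \<alpha>)) *s e_plus - symbol (\<beta> b \<alpha>) e_plus" for b
  define p where "p b = complex_of_real (norm (\<beta> b \<alpha>)) *s e_plus + symbol (\<beta> b \<alpha>) e_plus" for b
  \<comment> \<open>Every listed section is a single wave, so the eigenvalue and orthogonality
    claims become linear algebra in \<open>complex^2\<close>.\<close>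
  have E_cases: "(\<exists>b v. f = wave b v \<and> (good b \<and> (v = m b \<or> v = p b) \<or> \<not> good b \<and> (v = e_plus \<or> v = e_minus)))"
    if "f \<in> ?E" for f
    using that unfolding eigensections_wave m_def[symmetric] p_def[symmetric]
    unfolding sigma_pm_wave good_def by blast
  have sq: "symbol (\<beta> b \<alpha>) (symbol (\<beta> b \<alpha>) v)
      = complex_of_real (norm (\<beta> b \<alpha>)) *s (complex_of_real (norm (\<beta> b \<alpha>)) *s v)" for b v
    by (simp add: symbol_symbol power2_eq_square)
  have symbol_m: "symbol (\<beta> b \<alpha>) (m b) = - complex_of_real (norm (\<beta> b \<alpha>)) *s m b"
    and symbol_p: "symbol (\<beta> b \<alpha>) (p b) = complex_of_real (norm (\<beta> b \<alpha>)) *s p b" for b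
    using symbol_add[of "\<beta> b \<alpha>" "complex_of_real (norm (\<beta> b \<alpha>)) *s e_plus" "symbol (\<beta> b \<alpha>) e_plus"]
      symbol_add[of "\<beta> b \<alpha>" "complex_of_real (norm (\<beta> b \<alpha>)) *s e_plus" "- 1 *s symbol (\<beta> b \<alpha>) e_plus"]
    unfolding m_def p_def symbol_scale sq by (simp_all add: vec_eq_iff algebra_simps)
  \<comment> \<open>A nonzero second component cannot be cancelled by a multiple of
    \<open>e_plus\<close>; this is why \<open>m b\<close> and \<open>p b\<close> do not
    vanish.\<close>
  have good_nz: "symbol (\<beta> b \<alpha>) e_plus $ 2 \<noteq> 0" if "good b" for b
    using that by (auto simp: good_def symbol_def complex_eq_iff)
  have m_nz: "m b \<noteq> 0" and p_nz: "p b \<noteq> 0" if "good b" for b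
    using good_nz[OF that] by (auto simp: m_def p_def vec_eq_iff forall_2)
  \<comment> \<open>Here the symbol is diagonal. One of \<open>m b\<close> and \<open>p b\<close>
    would be 0, which is why the list uses \<open>e_plus\<close> and \<open>e_minus\<close> for
    these frequencies.\<close>
  have bad: "symbol (\<beta> b \<alpha>) e_plus = complex_of_real (\<beta> b \<alpha> $ 1) *s e_plus"
    "symbol (\<beta> b \<alpha>) e_minus = - complex_of_real (\<beta> b \<alpha> $ 1) *s e_minus" if "\<not> good b" for b
    using that by (auto simp: good_def symbol_def vec_eq_iff forall_2 complex_eq_iff)
  have e_nz: "e_plus \<noteq> 0" "e_minus \<noteq> 0"
    by (auto simp: vec_eq_iff forall_2)
  \<comment> \<open>The cross terms cancel because the symbol is Hermitian, the remaining ones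
    because its square is the scalar \<open>(norm (\<beta> b \<alpha>))\<^sup>2\<close>.\<close>
  have mp: "hdot (m b) (p b) = 0" for b
  proof -
    have "hdot (m b) (p b) = complex_of_real (norm (\<beta> b \<alpha>)) * complex_of_real (norm (\<beta> b \<alpha>)) * hdot e_plus e_plus
        - hdot (symbol (\<beta> b \<alpha>) e_plus) (symbol (\<beta> b \<alpha>) e_plus)
        + complex_of_real (norm (\<beta> b \<alpha>)) * (hdot e_plus (symbol (\<beta> b \<alpha>) e_plus) - hdot (symbol (\<beta> b \<alpha>) e_plus) e_plus)"
      by (simp add: m_def p_def hdot_def sum_2 algebra_simps)
    then show ?thesis
      by (simp add: hdot_symbol sq hdot_scale_right)
  qed
  then have pm: "hdot (p b) (m b) = 0" for b
  proof -
    have "hdot (p b) (m b) = cnj (hdot (m b) (p b))"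
      by (simp add: hdot_def mult.commute)
    with mp show ?thesis by simp
  qed
  have ee: "hdot e_plus e_minus = 0" "hdot e_minus e_plus = 0"
    by (simp_all add: hdot_def sum_2)
  have eigen: "f \<in> smooth_sections \<and> f \<noteq> 0 \<and> (\<exists>\<mu>. Dirac \<alpha> f = section_scale \<mu> f)" if f_E: "f \<in> ?E" for f
  proof -
    obtain b v where f: "f = wave b v"
      and v: "good b \<and> (v = m b \<or> v = p b) \<or> \<not> good b \<and> (v = e_plus \<or> v = e_minus)"
      using E_cases[OF f_E] by blast
    have "v \<noteq> 0" and "\<exists>\<mu>. symbol (\<beta> b \<alpha>) v = \<mu> *s v"
      using v m_nz p_nz e_nz symbol_m symbol_p bad by metis+
    moreover from \<open>v \<noteq> 0\<close> have "f \<noteq> 0"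
      using L2_norm_wave[of b v] by (auto simp: f L2_norm_def)
    ultimately show ?thesis
      using span_waves_smooth[OF wave_in_span] by (auto simp: f Dirac_wave wave_simps)
  qed
  have ortho: "L2_inner f g = 0" if fg: "f \<in> ?E" "g \<in> ?E" "f \<noteq> g" for f g
  proof -
    obtain b v where f: "f = wave b v"
      and v: "good b \<and> (v = m b \<or> v = p b) \<or> \<not> good b \<and> (v = e_plus \<or> v = e_minus)"
      using E_cases[OF fg(1)] by blast
    obtain c w where g: "g = wave c w"
      and w: "good c \<and> (w = m c \<or> w = p c) \<or> \<not> good c \<and> (w = e_plus \<or> w = e_minus)"
      using E_cases[OF fg(2)] by blast
    \<comment> \<open>At equal frequency distinct sections have distinct vectors, which leaves only
      the pairs \<open>m b\<close>, \<open>p b\<close> and \<open>e_plus\<close>,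
      \<open>e_minus\<close>.\<close>
    have "hdot v w = 0" if "b = c"
      using fg(3) v w that mp pm ee unfolding f g by metis
    then show ?thesis
      by (simp add: f g L2_inner_waves)
  qed
  have span: "sections.span waves \<subseteq> sections.span ?E"
  proof (rule sections.span_minimal)
    show "waves \<subseteq> sections.span ?E"
    proof
      fix f assume "f \<in> waves"
      then obtain b v where "f = wave b v" by blast
      then have f: "f \<in> sections.span {\<sigma>_plus b, \<sigma>_minus b}"
        using wave_in_span_pm by simp
      show "f \<in> sections.span ?E"
      proof (cases "\<beta> b \<alpha> $ 2 \<noteq> 0 \<or> \<beta> b \<alpha> $ 3 \<noteq> 0")
        case True
        from f[unfolded span_eigensections[OF True]] show ?thesis
          by (rule set_mp[OF sections.span_mono, rotated]) (use True in blast)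
      next
        case False
        from f show ?thesis
          by (rule set_mp[OF sections.span_mono, rotated]) (use False in blast)
      qed
    qed
  qed (rule sections.subspace_span)
  have dense: "\<exists>g\<in>sections.span ?E. L2_norm (h - g) < \<epsilon>" if h: "h \<in> L2" and \<epsilon>: "\<epsilon> > 0" for h \<epsilon>
  proof -
    obtain g where "g \<in> sections.span waves" "L2_norm (h - g) < \<epsilon>"
      using span_waves_L2_dense[OF h \<epsilon>] by blast
    then show ?thesis
      by (intro bexI[of _ g] subsetD[OF span])
  qed
  have "pairwise (\<lambda>f g. L2_inner f g = 0) ?E"
    by (intro pairwiseI ortho)
  moreover have "\<forall>f\<in>?E. f \<in> smooth_sections \<and> f \<noteq> 0 \<and> (\<exists>\<mu>. Dirac \<alpha> f = section_scale \<mu> f)"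
    by (intro ballI eigen)
  moreover have "\<forall>h\<in>L2. \<forall>\<epsilon>>0. \<exists>g\<in>sections.span ?E. L2_norm (h - g) < \<epsilon>"
    by (intro ballI allI impI dense)
  ultimately show "orthogonal_eigenbasis (Dirac \<alpha>) ?E"
    unfolding orthogonal_eigenbasis_def by (intro conjI)
qed

end
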